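(* Let $\mathcal{H}$ be a complex Hilbert space, $\mathcal{D}$ a dense subspace of $\mathcal{H}$, $\Omega$ a sesquilinear form on $\mathcal{D}$ which is q-closed with respect to a norm $\|\cdot\|_\Omega$, and $\Upsilon$ a bounded sesquilinear form on $\mathcal{H}$. Consider the following statements: (a) $N(\Omega+\Upsilon)=\{0\}$; (b) $N(\Omega^*+\Upsilon^* )=\{0\}$; (c) there exists a constant $c_1>0$ such that $c_1\|\xi\|_\Omega\le\sup_{\|\eta\|_\Omega=1}|(\Omega+\Upsilon)(\xi,\eta)|$ for all $\xi\in\mathcal{D}$; (d) there exists a constant $c_2>0$ such that $c_2\|\eta\|_\Omega\le\sup_{\|\xi\|_\Omega=1}|(\Omega+\Upsilon)(\xi,\eta)|$ for all $\eta\in\mathcal{D}$; (e) for every sequence $\{\xi_n\}$ in $\mathcal{D}$ such that $\sup_{\|\eta\|_\Omega=1}|(\Omega+\Upsilon)(\xi_n,\eta)|\to0$, one has $\|\xi_n\|_\Omega\to0$; (f) for every sequence $\{\eta_n\}$ in $\mathcal{D}$ such that $\sup_{\|\xi\|_\Omega=1}|(\Omega+\Upsilon)(\xi,\eta_n)|\to0$, one has $\|\eta_n\|_\Omega\to0$. Statements (c) and (e) are equivalent, and statements (d) and (f) are equivalent. Moreover, the following are equivalent: 1. $\Upsilon\in\mathfrak{P}(\Omega)$; 2. (a) and (d) hold; 3. (b) and (c) hold; 4. (c) and (d) hold.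
   Context: Let $\|\cdot\|$ be the norm of $\mathcal{H}$. Sesquilinear forms are linear in the first variable and conjugate linear in the second. The adjoint of a form $\Omega$ on $\mathcal{D}$ is $\Omega^*(\xi,\eta)=\overline{\Omega(\eta,\xi)}$. For a form $\Omega$ on $\mathcal{D}$, $N(\Omega)=\{\xi\in\mathcal{D}:\Omega(\xi,\eta)=0\ \forall\eta\in\mathcal{D}\}$. Sums such as $\Omega+\Upsilon$ are forms on $\mathcal{D}$. A sesquilinear form $\Omega$ on the dense subspace $\mathcal{D}$ is q-closed with respect to a norm $\|\cdot\|_\Omega$ on $\mathcal{D}$ if: (1) there is $\alpha>0$ with $\|\xi\|\le\alpha\|\xi\|_\Omega$ for all $\xi\in\mathcal{D}$; (2) if $\{\xi_n\}\subset\mathcal{D}$, $\|\xi_n\|\to0$ and $\|\xi_n-\xi_m\|_\Omega\to0$, then $\|\xi_n\|_\Omega\to0$; (3) $\mathcal{E}_\Omega:=\mathcal{D}[\|\cdot\|_\Omega]$ is a reflexive Banach space; (4) there is $\beta>0$ with $|\Omega(\xi,\eta)|\le\beta\|\xi\|_\Omega\|\eta\|_\Omega$ for all $\xi,\eta\in\mathcal{D}$. Let $\mathcal{E}_\Omega^\times$ be the conjugate dual of $\mathcal{E}_\Omega$ (bounded conjugate linear functionals). $\mathfrak{P}(\Omega)$ is the set of bounded sesquilinear forms $\Upsilon$ on $\mathcal{H}$ such that (i) $N(\Omega+\Upsilon)=\{0\}$; (ii) for every $\Lambda\in\mathcal{E}_\Omega^\times$ there is $\xi\in\mathcal{D}$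 with $\Lambda(\eta)=(\Omega+\Upsilon)(\xi,\eta)$ for all $\eta\in\mathcal{D}$. *)

theory Defs
  imports "HOL-Analysis.Analysis" "HOL-Library.Function_Algebras"
begin

class complex_vector = ab_group_add +
  fixes scaleC :: "complex \<Rightarrow> 'a \<Rightarrow> 'a" (infixr "*\<^sub>C" 75)
  assumes scaleC_add_right: "a *\<^sub>C (x + y) = a *\<^sub>C x + a *\<^sub>C y"
    and scaleC_add_left: "(a + b) *\<^sub>C x = a *\<^sub>C x + b *\<^sub>C x"
    and scaleC_scaleC: "a *\<^sub>C (b *\<^sub>C x) = (a * b) *\<^sub>C x"
    and scaleC_one: "1 *\<^sub>C x = x"

global_interpretation complex_vector:
  vector_space "scaleC :: complex \<Rightarrow> 'a \<Rightarrow> 'a::complex_vector"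
  by unfold_locales (fact scaleC_add_right scaleC_add_left scaleC_scaleC scaleC_one)+

(* Pointwise scalar multiplication. Addition of functions (in particular of forms) is pointwise
   by Function_Algebras; the present instance makes the dual of a dual space an instance of the
   same construction as the dual itself. *)
instantiation "fun" :: (type, complex_vector) complex_vector
begin

definition scaleC_fun :: "complex \<Rightarrow> ('a \<Rightarrow> 'b) \<Rightarrow> 'a \<Rightarrow> 'b"
  where "scaleC_fun c f = (\<lambda>x. c *\<^sub>C f x)"

instance
  by standard
    (simp_all add: scaleC_fun_def plus_fun_def fun_eq_iff
      scaleC_add_right scaleC_add_left scaleC_scaleC scaleC_one)

end

instantiation complex :: complex_vector
begin

definition scaleC_complex :: "complex \<Rightarrow> complex \<Rightarrow> complex"
  where "scaleC_complex a x = a * x"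

instance
  by standard (simp_all add: scaleC_complex_def algebra_simps)

end

(* The inner product is linear in the first variable. The norm axioms contained in banach are
   consequences of the inner product axioms, except for completeness. *)
class complex_hilbert = complex_vector + banach +
  fixes cinner :: "'a \<Rightarrow> 'a \<Rightarrow> complex"
  assumes scaleR_scaleC: "r *\<^sub>R x = complex_of_real r *\<^sub>C x"
    and cinner_add_left: "cinner (x + y) z = cinner x z + cinner y z"
    and cinner_scaleC_left: "cinner (a *\<^sub>C x) y = a * cinner x y"
    and cinner_commute: "cinner x y = cnj (cinner y x)"
    and cinner_nonneg: "0 \<le> Re (cinner x x)"
    and cinner_eq_zero_iff: "cinner x x = 0 \<longleftrightarrow> x = 0"
    and norm_eq_sqrt_cinner: "norm x = sqrt (Re (cinner x x))"

(* Norms and forms on a carrier are total functions of which only the values on the carrier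
   matter. *)

definition is_norm_on :: "'a::complex_vector set \<Rightarrow> ('a \<Rightarrow> real) \<Rightarrow> bool" where
  "is_norm_on V N \<longleftrightarrow>
     (\<forall>x\<in>V. 0 \<le> N x) \<and>
     (\<forall>x\<in>V. N x = 0 \<longleftrightarrow> x = 0) \<and>
     (\<forall>c. \<forall>x\<in>V. N (c *\<^sub>C x) = cmod c * N x) \<and>
     (\<forall>x\<in>V. \<forall>y\<in>V. N (x + y) \<le> N x + N y)"

definition Cauchy_wrt :: "('a::complex_vector \<Rightarrow> real) \<Rightarrow> (nat \<Rightarrow> 'a) \<Rightarrow> bool" where
  "Cauchy_wrt N X \<longleftrightarrow> (\<forall>e>0. \<exists>M. \<forall>m\<ge>M. \<forall>n\<ge>M. N (X n - X m) < e)"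

definition is_banach_on :: "'a::complex_vector set \<Rightarrow> ('a \<Rightarrow> real) \<Rightarrow> bool" where
  "is_banach_on V N \<longleftrightarrow>
     complex_vector.subspace V \<and> is_norm_on V N \<and>
     (\<forall>X. (\<forall>n. X n \<in> V) \<and> Cauchy_wrt N X \<longrightarrow>
        (\<exists>l\<in>V. (\<lambda>n. N (X n - l)) \<longlonglongrightarrow> 0))"

(* Functionals on V are represented by total functions vanishing outside V, so that each
   functional has exactly one representative. *)
definition dual_space :: "'a::complex_vector set \<Rightarrow> ('a \<Rightarrow> real) \<Rightarrow> ('a \<Rightarrow> complex) set" where
  "dual_space V N =
     {f. (\<forall>x\<in>V. \<forall>y\<in>V. f (x + y) = f x + f y) \<and>
         (\<forall>c. \<forall>x\<in>V. f (c *\<^sub>C x) = c * f x) \<and>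
         (\<exists>C. \<forall>x\<in>V. cmod (f x) \<le> C * N x) \<and>
         (\<forall>x. x \<notin> V \<longrightarrow> f x = 0)}"

definition dual_norm :: "'a::complex_vector set \<Rightarrow> ('a \<Rightarrow> real) \<Rightarrow> ('a \<Rightarrow> complex) \<Rightarrow> real" where
  "dual_norm V N f = (SUP x\<in>{x\<in>V. N x \<le> 1}. cmod (f x))"

definition conj_dual_space :: "'a::complex_vector set \<Rightarrow> ('a \<Rightarrow> real) \<Rightarrow> ('a \<Rightarrow> complex) set" where
  "conj_dual_space V N =
     {f. (\<forall>x\<in>V. \<forall>y\<in>V. f (x + y) = f x + f y) \<and>
         (\<forall>c. \<forall>x\<in>V. f (c *\<^sub>C x) = cnj c * f x) \<and>
         (\<exists>C. \<forall>x\<in>V. cmod (f x) \<le> C * N x) \<and>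
         (\<forall>x. x \<notin> V \<longrightarrow> f x = 0)}"

definition is_reflexive_banach_on :: "'a::complex_vector set \<Rightarrow> ('a \<Rightarrow> real) \<Rightarrow> bool" where
  "is_reflexive_banach_on V N \<longleftrightarrow>
     is_banach_on V N \<and>
     (\<forall>F\<in>dual_space (dual_space V N) (dual_norm V N).
        \<exists>x\<in>V. \<forall>f\<in>dual_space V N. F f = f x)"

definition sesquilinear_on :: "'a::complex_vector set \<Rightarrow> ('a \<Rightarrow> 'a \<Rightarrow> complex) \<Rightarrow> bool" where
  "sesquilinear_on D \<Omega> \<longleftrightarrow>
     (\<forall>x\<in>D. \<forall>y\<in>D. \<forall>z\<in>D. \<Omega> (x + y) z = \<Omega> x z + \<Omega> y z) \<and>
     (\<forall>c. \<forall>x\<in>D. \<forall>z\<in>D. \<Omega> (c *\<^sub>C x) z = c * \<Omega> x z) \<and>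
     (\<forall>x\<in>D. \<forall>y\<in>D. \<forall>z\<in>D. \<Omega> x (y + z) = \<Omega> x y + \<Omega> x z) \<and>
     (\<forall>c. \<forall>x\<in>D. \<forall>z\<in>D. \<Omega> x (c *\<^sub>C z) = cnj c * \<Omega> x z)"

definition bounded_sesquilinear :: "('a::complex_hilbert \<Rightarrow> 'a \<Rightarrow> complex) \<Rightarrow> bool" where
  "bounded_sesquilinear \<Upsilon> \<longleftrightarrow>
     sesquilinear_on UNIV \<Upsilon> \<and> (\<exists>C. \<forall>x y. cmod (\<Upsilon> x y) \<le> C * norm x * norm y)"

definition adjoint_form :: "('a \<Rightarrow> 'a \<Rightarrow> complex) \<Rightarrow> 'a \<Rightarrow> 'a \<Rightarrow> complex" where
  "adjoint_form \<Omega> \<xi> \<eta> = cnj (\<Omega> \<eta> \<xi>)"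

definition null_form :: "'a set \<Rightarrow> ('a \<Rightarrow> 'a \<Rightarrow> complex) \<Rightarrow> 'a set" where
  "null_form D \<Omega> = {\<xi>\<in>D. \<forall>\<eta>\<in>D. \<Omega> \<xi> \<eta> = 0}"

definition q_closed ::
  "'a::complex_hilbert set \<Rightarrow> ('a \<Rightarrow> real) \<Rightarrow> ('a \<Rightarrow> 'a \<Rightarrow> complex) \<Rightarrow> bool" where
  "q_closed D N \<Omega> \<longleftrightarrow>
     is_norm_on D N \<and>
     (\<exists>\<alpha>>0. \<forall>\<xi>\<in>D. norm \<xi> \<le> \<alpha> * N \<xi>) \<and>
     (\<forall>\<xi>. (\<forall>n. \<xi> n \<in> D) \<and> (\<lambda>n. norm (\<xi> n)) \<longlonglongrightarrow> 0 \<and> Cauchy_wrt N \<xi> \<longrightarrow>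
        (\<lambda>n. N (\<xi> n)) \<longlonglongrightarrow> 0) \<and>
     is_reflexive_banach_on D N \<and>
     (\<exists>\<beta>>0. \<forall>\<xi>\<in>D. \<forall>\<eta>\<in>D. cmod (\<Omega> \<xi> \<eta>) \<le> \<beta> * N \<xi> * N \<eta>)"

(* The set of the bounded forms denoted by a fraktur P; it refers to the norm on D through the
   conjugate dual. *)
definition perturbations ::
  "'a::complex_hilbert set \<Rightarrow> ('a \<Rightarrow> real) \<Rightarrow> ('a \<Rightarrow> 'a \<Rightarrow> complex) \<Rightarrow> ('a \<Rightarrow> 'a \<Rightarrow> complex) set" where
  "perturbations D N \<Omega> =
     {\<Upsilon>. bounded_sesquilinear \<Upsilon> \<and>
          null_form D (\<Omega> + \<Upsilon>) = {0} \<and>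
          (\<forall>\<Lambda>\<in>conj_dual_space D N. \<exists>\<xi>\<in>D. \<forall>\<eta>\<in>D. \<Lambda> \<eta> = (\<Omega> + \<Upsilon>) \<xi> \<eta>)}"

(* The supremum of a form over the unit sphere of (D, N) in its second, resp. first, variable.
   It is taken in ennreal, so that it equals 0 in the degenerate case D = {0}, where the sphere is
   empty (the supremum of the empty set is unspecified in type real). *)
definition sphere_sup_right ::
  "'a set \<Rightarrow> ('a \<Rightarrow> real) \<Rightarrow> ('a \<Rightarrow> 'a \<Rightarrow> complex) \<Rightarrow> 'a \<Rightarrow> ennreal" where
  "sphere_sup_right D N \<Omega> \<xi> = (SUP \<eta>\<in>{\<eta>\<in>D. N \<eta> = 1}. ennreal (cmod (\<Omega> \<xi> \<eta>)))"

definition sphere_sup_left ::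
  "'a set \<Rightarrow> ('a \<Rightarrow> real) \<Rightarrow> ('a \<Rightarrow> 'a \<Rightarrow> complex) \<Rightarrow> 'a \<Rightarrow> ennreal" where
  "sphere_sup_left D N \<Omega> \<eta> = (SUP \<xi>\<in>{\<xi>\<in>D. N \<xi> = 1}. ennreal (cmod (\<Omega> \<xi> \<eta>)))"

end

theory Submission
  imports Defs
begin

text \<open>Put \<open>B = \<Omega> + \<Upsilon>\<close>, a bounded form on the reflexive space \<open>(D, N)\<close>. If \<open>B(\<cdot>, y)\<close> is bounded below
  in \<open>y\<close> (statement (d)), then for every bounded conjugate linear \<open>\<Lambda>\<close> the map \<open>B(\<cdot>, y) \<mapsto> \<Lambda> y\<close> is a
  bounded functional on a subspace of the dual; by Hahn--Banach and reflexivity it is evaluation at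
  some \<open>x\<close> with \<open>N x\<close> controlled by the norm of \<open>\<Lambda>\<close>, so that \<open>\<Lambda> = B(x, \<cdot>)\<close>. If \<open>x\<close> is moreover unique
  (statement (a)), the estimate of \<open>N x\<close> is statement (c). Conversely, if every \<open>\<Lambda>\<close> is represented,
  then (d) follows from the uniform boundedness principle on the dual. Statements (b), (c) are (a),
  (d) for the adjoint form, and (d) trivially implies (b).\<close>

section \<open>The Hahn--Banach theorem\<close>

definition sublinear :: "('a::complex_vector \<Rightarrow> real) \<Rightarrow> bool" where
  "sublinear q \<longleftrightarrow> (\<forall>x y. q (x + y) \<le> q x + q y) \<and> (\<forall>t\<ge>0. \<forall>x. q (of_real t *\<^sub>C x) = t * q x)"

text \<open>The inequality for \<open>t\<close> and the one for \<open>1 / t\<close>, applied to the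
  rescaled vector, together give equality.\<close>

lemma sublinearI:
  assumes zero: "q 0 = 0" and add: "\<And>x y. q (x + y) \<le> q x + q y"
    and scale: "\<And>t x. t > 0 \<Longrightarrow> q (of_real t *\<^sub>C x) \<le> t * q x"
  shows "sublinear q"
proof -
  have "q (of_real t *\<^sub>C x) = t * q x" if "t \<ge> 0" for t x
  proof (cases "t = 0")
    case True
    then show ?thesis by (simp add: zero)
  next
    case False
    then have t: "t > 0" using that by simp
    have "q (of_real (1 / t) *\<^sub>C of_real t *\<^sub>C x) \<le> 1 / t * q (of_real t *\<^sub>C x)"
      by (rule scale) (use t in simp)
    also have "of_real (1 / t) *\<^sub>C of_real t *\<^sub>C x = x"
      using t by simp
    finally show ?thesis using scale[OF t, of x] t by (simp add: field_simps)
  qed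
  then show ?thesis using add by (simp add: sublinear_def)
qed

lemma sublinear_add: "sublinear q \<Longrightarrow> q (x + y) \<le> q x + q y"
  and sublinear_scale: "sublinear q \<Longrightarrow> t \<ge> 0 \<Longrightarrow> q (of_real t *\<^sub>C x) = t * q x"
  by (auto simp: sublinear_def)

lemma sublinear_zero: "sublinear q \<Longrightarrow> q 0 = 0"
  using sublinear_scale[of q 0 0] by simp

lemma sublinear_minus: "sublinear q \<Longrightarrow> - q (- x) \<le> q x"
  using sublinear_add[of q x "- x"] sublinear_zero[of q] by simp

text \<open>Infimal convolution: \<open>G\<close> is a convex cone of pairs, each prescribing an
  upper bound \<open>r\<close> at \<open>v\<close>, and \<open>q'\<close> is the infimum of
  \<open>q (x - v) + r\<close> over \<open>G\<close>. The last hypothesis is the compatibility that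
  keeps this infimum finite. It serves both to impose the values of a given graph and to decrease a
  functional along a ray.\<close>

lemma sublinear_below_on_cone:
  fixes q :: "'a::complex_vector \<Rightarrow> real"
  assumes q: "sublinear q" and ne: "G \<noteq> {}"
    and add: "\<And>v r w s. (v, r) \<in> G \<Longrightarrow> (w, s) \<in> G \<Longrightarrow> (v + w, r + s) \<in> G"
    and scale: "\<And>t v r. t \<ge> 0 \<Longrightarrow> (v, r) \<in> G \<Longrightarrow> (of_real t *\<^sub>C v, t * r) \<in> G"
    and below: "\<And>v r. (v, r) \<in> G \<Longrightarrow> - r \<le> q (- v)"
  shows "\<exists>q'. sublinear q' \<and> q' \<le> q \<and> (\<forall>(v, r)\<in>G. q' v \<le> r)"
proof -
  have zero: "(0, 0) \<in> G"
    using ne scale[of 0] by fastforce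
  define h where "h x = (\<lambda>(v, r). q (x - v) + r)" for x :: 'a
  have low: "- q (- x) \<le> q (x - v) + r" if "(v, r) \<in> G" for x v r
    using below[OF that] sublinear_add[OF q, of "x - v" "- x"] by simp
  have bdd: "bdd_below (h x ` G)" for x
    by (rule bdd_belowI[of _ "- q (- x)"]) (use low in \<open>auto simp: h_def\<close>)
  define q' where "q' x = (INF g\<in>G. h x g)" for x
  have q'_le: "q' x \<le> q (x - v) + r" if "(v, r) \<in> G" for x v r
    unfolding q'_def using cINF_lower[OF bdd that, of x] by (simp add: h_def)
  have le_q': "c \<le> q' x" if "\<And>v r. (v, r) \<in> G \<Longrightarrow> c \<le> q (x - v) + r" for c x
    unfolding q'_def by (rule cINF_greatest[OF ne]) (use that in \<open>auto simp: h_def\<close>)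
  have "sublinear q'"
  proof (rule sublinearI)
    show "q' 0 = 0"
    proof (rule antisym)
      show "q' 0 \<le> 0" using q'_le[OF zero, of 0] sublinear_zero[OF q] by simp
      show "0 \<le> q' 0" by (rule le_q') (use low[of _ _ 0] sublinear_zero[OF q] in simp)
    qed
    fix x y
    \<comment> \<open>The two infima are taken one after the other: first over the pairs used at
      \<open>x\<close> with \<open>(w, s)\<close> fixed, then over \<open>(w, s)\<close>.\<close>
    have "q' (x + y) - (q (y - w) + s) \<le> q' x" if w: "(w, s) \<in> G" for w s
    proof (rule le_q')
      fix v r assume v: "(v, r) \<in> G"
      have "q (x + y - (v + w)) \<le> q (x - v) + q (y - w)"
        using sublinear_add[OF q, of "x - v" "y - w"] by (simp add: algebra_simps)
      then show "q' (x + y) - (q (y - w) + s) \<le> q (x - v) + r"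
        using q'_le[OF add[OF v w], of "x + y"] by simp
    qed
    then have "q' (x + y) - q' x \<le> q' y"
      by (intro le_q') (simp add: algebra_simps)
    then show "q' (x + y) \<le> q' x + q' y" by simp
  next
    fix t :: real and x assume t: "t > 0"
    have "q' (of_real t *\<^sub>C x) / t \<le> q' x"
    proof (rule le_q')
      fix v r assume v: "(v, r) \<in> G"
      have "q (of_real t *\<^sub>C x - of_real t *\<^sub>C v) = t * q (x - v)"
        using sublinear_scale[OF q, of t "x - v"] t
        by (simp add: complex_vector.scale_right_diff_distrib)
      then show "q' (of_real t *\<^sub>C x) / t \<le> q (x - v) + r"
        using q'_le[OF scale[OF _ v, of t], of "of_real t *\<^sub>C x"] t
        by (simp add: field_simps)
    qed
    then show "q' (of_real t *\<^sub>C x) \<le> t * q' x" using t by (simp add: field_simps)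
  qed
  moreover have "q' \<le> q" using q'_le[OF zero] by (simp add: le_fun_def)
  moreover have "q' v \<le> r" if "(v, r) \<in> G" for v r
    using q'_le[OF that, of v] sublinear_zero[OF q] by simp
  ultimately show ?thesis by (intro exI[of _ q']) auto
qed

text \<open>The pointwise infimum works. It is finite because every member satisfies
  \<open>- p (- x) \<le> q x\<close>, and it is subadditive because two members of the chain can be
  replaced by the smaller one. This is the chain condition of Zorn's lemma.\<close>

lemma sublinear_chain_bound:
  fixes p :: "'a::complex_vector \<Rightarrow> real"
  assumes ne: "C \<noteq> {}"
    and sub: "\<And>q. q \<in> C \<Longrightarrow> sublinear q \<and> q \<le> p"
    and chain: "\<And>q r. q \<in> C \<Longrightarrow> r \<in> C \<Longrightarrow> q \<le> r \<or> r \<le> q"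
  shows "\<exists>u. sublinear u \<and> u \<le> p \<and> (\<forall>q\<in>C. u \<le> q)"
proof -
  define u where "u x = (INF q\<in>C. q x)" for x
  have "- p (- x) \<le> q x" if "q \<in> C" for q x
  proof -
    have "q (- x) \<le> p (- x)" using sub[OF that] by (auto simp: le_fun_def)
    then show ?thesis using sublinear_minus[of q x] sub[OF that] by simp
  qed
  then have bdd: "bdd_below ((\<lambda>q. q x) ` C)" for x
    by (intro bdd_belowI[of _ "- p (- x)"]) auto
  have u_le: "u x \<le> q x" if "q \<in> C" for q x
    unfolding u_def by (rule cINF_lower[OF bdd that])
  have le_u: "c \<le> u x" if "\<And>q. q \<in> C \<Longrightarrow> c \<le> q x" for c x
    unfolding u_def by (rule cINF_greatest[OF ne]) (rule that)
  have "sublinear u"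
  proof (rule sublinearI)
    obtain q where "q \<in> C" using ne by auto
    then have "u 0 \<le> 0" using u_le[of q 0] sub sublinear_zero[of q] by simp
    moreover have "0 \<le> u 0" by (rule le_u) (use sub sublinear_zero in force)
    ultimately show "u 0 = 0" by simp
    fix x y
    have "u (x + y) - r y \<le> u x" if r: "r \<in> C" for r
    proof (rule le_u)
      fix q assume q: "q \<in> C"
      obtain s where s: "s \<in> C" "s \<le> q" "s \<le> r" using chain[OF q r] q r by auto
      have "u (x + y) \<le> s (x + y)" by (rule u_le[OF s(1)])
      also have "\<dots> \<le> s x + s y" using sub[OF s(1)] sublinear_add by blast
      also have "\<dots> \<le> q x + r y" using s(2,3) by (intro add_mono) (auto simp: le_fun_def)
      finally show "u (x + y) - r y \<le> q x" by simp
    qed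
    then have "u (x + y) - u x \<le> u y"
      by (intro le_u) (simp add: algebra_simps)
    then show "u (x + y) \<le> u x + u y" by simp
  next
    fix t :: real and x assume t: "t > 0"
    have "u (of_real t *\<^sub>C x) / t \<le> u x"
    proof (rule le_u)
      fix q assume q: "q \<in> C"
      then have "q (of_real t *\<^sub>C x) = t * q x" using sub sublinear_scale[of q t x] t by auto
      then show "u (of_real t *\<^sub>C x) / t \<le> q x"
        using u_le[OF q, of "of_real t *\<^sub>C x"] t by (simp add: field_simps)
    qed
    then show "u (of_real t *\<^sub>C x) \<le> t * u x" using t by (simp add: field_simps)
  qed
  moreover obtain q where "q \<in> C" using ne by auto
  then have "u \<le> p" using u_le sub by (fastforce simp: le_fun_def intro: order_trans)
  ultimately show ?thesis using u_le by (auto simp: le_fun_def)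
qed

text \<open>A minimal sublinear functional \<open>m\<close> is odd, hence additive: otherwise it could be
  decreased further at some \<open>- y\<close> along the ray through \<open>- y\<close>.\<close>
lemma additive_below_sublinear:
  fixes p :: "'a::complex_vector \<Rightarrow> real"
  assumes p: "sublinear p"
  shows "\<exists>m. sublinear m \<and> m \<le> p \<and> (\<forall>x y. m (x + y) = m x + m y)"
proof -
  define A where "A = {q. sublinear q \<and> q \<le> p}"
  \<comment> \<open>The order is reversed, so that the maximal element supplied by Zorn's lemma is a
    minimal sublinear functional.\<close>
  let ?P = "\<lambda>q r :: 'a \<Rightarrow> real. r \<le> q"
  have "\<exists>m\<in>A. \<forall>q\<in>A. q \<le> m \<longrightarrow> q = m"
  proof (rule predicate_Zorn)
    show "partial_order_on A (relation_of ?P A)"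
      by (auto simp: partial_order_on_def preorder_on_def relation_of_def
          refl_on_def intro!: transI antisymI)
    fix C assume C: "C \<in> Chains (relation_of ?P A)"
    then have CA: "C \<subseteq> A" and ch: "\<And>q r. q \<in> C \<Longrightarrow> r \<in> C \<Longrightarrow> q \<le> r \<or> r \<le> q"
      by (auto simp: Chains_def relation_of_def)
    show "\<exists>u\<in>A. \<forall>q\<in>C. u \<le> q"
    proof (cases "C = {}")
      case True
      then show ?thesis using p by (auto simp: A_def)
    next
      case False
      have "\<exists>u. sublinear u \<and> u \<le> p \<and> (\<forall>q\<in>C. u \<le> q)"
        by (rule sublinear_chain_bound[OF False _ ch]) (use CA in \<open>auto simp: A_def\<close>)
      then show ?thesis by (auto simp: A_def)
    qed
  qed
  then obtain m where m: "sublinear m" "m \<le> p"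
    and minimal: "\<And>q. sublinear q \<Longrightarrow> q \<le> m \<Longrightarrow> q = m"
    by (auto simp: A_def intro: order_trans)
  have odd: "m (- y) \<le> - m y" for y
  proof -
    \<comment> \<open>The ray through \<open>- y\<close>, with the bound that an odd functional
      would attain there. Compatibility holds with equality, and minimality of \<open>m\<close>
      forces the resulting functional to be \<open>m\<close> itself.\<close>
    define G where "G = (\<lambda>t. (of_real t *\<^sub>C (- y), - (t * m y))) ` {0..}"
    have "\<exists>q'. sublinear q' \<and> q' \<le> m \<and> (\<forall>(v, r)\<in>G. q' v \<le> r)"
    proof (rule sublinear_below_on_cone[OF m(1)])
      show "G \<noteq> {}" by (auto simp: G_def)
      fix v r w s assume "(v, r) \<in> G" "(w, s) \<in> G"
      then obtain t t' where "t \<ge> 0" "t' \<ge> 0" "v = of_real t *\<^sub>C (- y)" "r = - (t * m y)"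
          "w = of_real t' *\<^sub>C (- y)" "s = - (t' * m y)"
        by (auto simp: G_def)
      then show "(v + w, r + s) \<in> G" unfolding G_def
        by (intro image_eqI[of _ _ "t + t'"])
          (auto simp: algebra_simps)
    next
      fix t :: real and v r assume t: "t \<ge> 0" and "(v, r) \<in> G"
      then obtain t' where "t' \<ge> 0" "v = of_real t' *\<^sub>C (- y)" "r = - (t' * m y)"
        by (auto simp: G_def)
      then show "(of_real t *\<^sub>C v, t * r) \<in> G" unfolding G_def using t
        by (intro image_eqI[of _ _ "t * t'"]) auto
    next
      fix v r assume "(v, r) \<in> G"
      then show "- r \<le> m (- v)" by (auto simp: G_def sublinear_scale[OF m(1)])
    qed
    then have "\<forall>(v, r)\<in>G. m v \<le> r" using minimal by blast
    moreover have "(- y, - m y) \<in> G"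
      unfolding G_def by (intro image_eqI[of _ _ 1]) auto
    ultimately show ?thesis by auto
  qed
  have "m (x + y) = m x + m y" for x y
    using sublinear_add[OF m(1), of x y] sublinear_add[OF m(1), of "x + y" "- y"] odd[of y]
    by simp
  then show ?thesis using m by blast
qed

text \<open>The functional to be extended is given by its graph \<open>G\<close>; that \<open>G\<close> is single-valued
  follows from the conclusion.\<close>
lemma Hahn_Banach_graph_UNIV:
  fixes p :: "'a::complex_vector \<Rightarrow> real"
  assumes padd: "\<And>x y. p (x + y) \<le> p x + p y" and pscale: "\<And>c x. p (c *\<^sub>C x) = cmod c * p x"
    and ne: "G \<noteq> {}"
    and add: "\<And>v a w b. (v, a) \<in> G \<Longrightarrow> (w, b) \<in> G \<Longrightarrow> (v + w, a + b) \<in> G"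
    and scale: "\<And>c v a. (v, a) \<in> G \<Longrightarrow> (c *\<^sub>C v, c * a) \<in> G"
    and dom: "\<And>v a. (v, a) \<in> G \<Longrightarrow> cmod a \<le> p v"
  shows "\<exists>F. (\<forall>x y. F (x + y) = F x + F y) \<and> (\<forall>c x. F (c *\<^sub>C x) = c * F x) \<and>
    (\<forall>x. cmod (F x) \<le> p x) \<and> (\<forall>(v, a)\<in>G. F v = a)"
proof -
  have pminus: "p (- x) = p x" for x using pscale[of "-1" x] by simp
  have p: "sublinear p"
    using padd pscale by (simp add: sublinear_def)
  \<comment> \<open>Only real parts are prescribed at first; the imaginary parts follow from closure
    of \<open>G\<close> under multiplication by \<open>\<i>\<close>.\<close>
  define H where "H = (\<lambda>(v, a). (v, Re a)) ` G"
  have "\<exists>q'. sublinear q' \<and> q' \<le> p \<and> (\<forall>(v, r)\<in>H. q' v \<le> r)"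
  proof (rule sublinear_below_on_cone[OF p])
    show "H \<noteq> {}" using ne by (simp add: H_def)
    fix v r w s assume "(v, r) \<in> H" "(w, s) \<in> H"
    then obtain a b where "(v, a) \<in> G" "r = Re a" "(w, b) \<in> G" "s = Re b" by (auto simp: H_def)
    then show "(v + w, r + s) \<in> H"
      unfolding H_def by (intro image_eqI[of _ _ "(v + w, a + b)"]) (auto intro: add)
  next
    fix t :: real and v r assume "(v, r) \<in> H"
    then obtain a where "(v, a) \<in> G" "r = Re a" by (auto simp: H_def)
    then show "(of_real t *\<^sub>C v, t * r) \<in> H"
      unfolding H_def by (intro image_eqI[of _ _ "(of_real t *\<^sub>C v, of_real t * a)"]) (auto intro: scale)
  next
    fix v r assume "(v, r) \<in> H"
    then obtain a where "(v, a) \<in> G" "r = Re a" by (auto simp: H_def)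
    then show "- r \<le> p (- v)"
      using dom[of v a] abs_Re_le_cmod[of a] by (simp add: pminus)
  qed
  then obtain q where q: "sublinear q" "q \<le> p" and qG: "\<And>v a. (v, a) \<in> G \<Longrightarrow> q v \<le> Re a"
    by (force simp: H_def)
  obtain m where m: "sublinear m" "m \<le> q" and madd: "\<And>x y. m (x + y) = m x + m y"
    using additive_below_sublinear[OF q(1)] by blast
  have mminus: "m (- x) = - m x" for x
    using madd[of x "- x"] sublinear_zero[OF m(1)] by simp
  have mscale: "m (of_real t *\<^sub>C x) = t * m x" for t x
  proof (cases "t \<ge> 0")
    case False
    then show ?thesis
      using sublinear_scale[OF m(1), of "- t" x] mminus[of "of_real t *\<^sub>C x"] by simp
  qed (rule sublinear_scale[OF m(1)])
  have mp: "m x \<le> p x" for x using m(2) q(2) by (auto simp: le_fun_def intro: order_trans)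
  \<comment> \<open>Below \<open>q\<close> only an upper bound on \<open>G\<close> is known; the
    bound at \<open>- v\<close> and oddness of \<open>m\<close> turn it into equality.\<close>
  have mG: "m v = Re a" if G: "(v, a) \<in> G" for v a
  proof (rule antisym)
    have le: "m v \<le> Re a" if "(v, a) \<in> G" for v a
      using qG[OF that] m(2) by (auto simp: le_fun_def intro: order_trans)
    show "m v \<le> Re a" by (rule le[OF G])
    have "m (- v) \<le> Re (- a)" using le[OF scale[OF G, of "-1"]] by simp
    then show "Re a \<le> m v" by (simp add: mminus)
  qed
  \<comment> \<open>The unique complex linear functional with real part \<open>m\<close>.\<close>
  define F where "F x = Complex (m x) (- m (\<i> *\<^sub>C x))" for x
  have decompose: "c *\<^sub>C x = of_real (Re c) *\<^sub>C x + of_real (Im c) *\<^sub>C \<i> *\<^sub>C x" for c and x :: 'a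
  proof -
    have "of_real (Re c) *\<^sub>C x + of_real (Im c) *\<^sub>C \<i> *\<^sub>C x = (of_real (Re c) + of_real (Im c) * \<i>) *\<^sub>C x"
      by (simp add: scaleC_add_left)
    also have "of_real (Re c) + of_real (Im c) * \<i> = c" by (simp add: complex_eq_iff)
    finally show ?thesis by simp
  qed
  have mscaleC: "m (c *\<^sub>C x) = Re c * m x + Im c * m (\<i> *\<^sub>C x)" for c x
    by (subst decompose) (simp only: madd mscale)
  have Fadd: "F (x + y) = F x + F y" for x y
    by (simp add: F_def scaleC_add_right madd complex_eq_iff)
  have Fscale: "F (c *\<^sub>C x) = c * F x" for c x
    using mscaleC[of c x] mscaleC[of "\<i> * c" x]
    by (simp add: F_def complex_eq_iff)
  have "cmod (F x) \<le> p x" for x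
  proof (cases "F x = 0")
    case True
    \<comment> \<open>Here only \<open>0 \<le> p x\<close> is at stake; it follows from the bounds
      on \<open>m\<close> at \<open>x\<close> and at \<open>- x\<close>.\<close>
    have "m (- x) \<le> p x" using mp[of "- x"] by (simp add: pminus)
    then show ?thesis using True mp[of x] mminus[of x] by simp
  next
    case False
    \<comment> \<open>The phase that rotates \<open>F x\<close> onto the positive real axis, where
      \<open>F\<close> coincides with its real part \<open>m\<close>.\<close>
    define c where "c = cnj (F x) / cmod (F x)"
    have c: "cmod c = 1" using False by (simp add: c_def norm_divide)
    have "c * F x = of_real (cmod (F x))"
      using False complex_norm_square[of "F x"]
      by (simp add: c_def field_simps power2_eq_square)
    then have "cmod (F x) = Re (F (c *\<^sub>C x))" by (simp add: Fscale)
    also have "\<dots> \<le> p (c *\<^sub>C x)" by (simp add: F_def mp)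
    also have "\<dots> = p x" by (simp add: pscale c)
    finally show ?thesis .
  qed
  moreover have "F v = a" if "(v, a) \<in> G" for v a
    using mG[OF that] mG[OF scale[OF that, of \<i>]] by (simp add: F_def complex_eq_iff)
  ultimately show ?thesis using Fadd Fscale by (intro exI[of _ F]) auto
qed

section \<open>Extension of functionals on a normed subspace\<close>

text \<open>A purely algebraic projection, obtained as a linear left inverse of the identity on
  \<open>V\<close>. Composing with it turns a norm on the carrier into a seminorm on the whole
  type.\<close>

lemma subspace_projection:
  fixes V :: "'a::complex_vector set"
  assumes "complex_vector.subspace V"
  obtains P where "\<And>x. P x \<in> V" "\<And>x. x \<in> V \<Longrightarrow> P x = x"
    "\<And>x y. P (x + y) = P x + P y" "\<And>c x. P (c *\<^sub>C x) = c *\<^sub>C P x"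
proof -
  interpret vector_space_pair "scaleC :: complex \<Rightarrow> 'a \<Rightarrow> 'a" "scaleC :: complex \<Rightarrow> 'a \<Rightarrow> 'a" ..
  have "\<exists>g. g ` UNIV \<subseteq> V \<and> Vector_Spaces.linear scaleC scaleC g \<and> (\<forall>v\<in>V. g (id v) = v)"
    by (rule linear_exists_left_inverse_on[OF complex_vector.linear_id assms]) simp
  then obtain P where "range P \<subseteq> V" "Vector_Spaces.linear scaleC scaleC P" "\<forall>v\<in>V. P v = v"
    by auto
  then show ?thesis
    by (intro that[of P])
      (auto simp: linear_add linear_scale)
qed

text \<open>The extension theorem on the whole type is applied to the seminorm
  \<open>K * N (P x)\<close>, which agrees with \<open>K * N x\<close> on \<open>V\<close>.\<close>

lemma Hahn_Banach_graph:
  fixes V :: "'a::complex_vector set"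
  assumes V: "complex_vector.subspace V" and N: "is_norm_on V N"
    and K: "K \<ge> 0" and GV: "fst ` G \<subseteq> V" and ne: "G \<noteq> {}"
    and add: "\<And>v a w b. (v, a) \<in> G \<Longrightarrow> (w, b) \<in> G \<Longrightarrow> (v + w, a + b) \<in> G"
    and scale: "\<And>c v a. (v, a) \<in> G \<Longrightarrow> (c *\<^sub>C v, c * a) \<in> G"
    and dom: "\<And>v a. (v, a) \<in> G \<Longrightarrow> cmod a \<le> K * N v"
  shows "\<exists>F\<in>dual_space V N. (\<forall>x\<in>V. cmod (F x) \<le> K * N x) \<and> (\<forall>(v, a)\<in>G. F v = a)"
proof -
  obtain P where P: "\<And>x. P x \<in> V" "\<And>x. x \<in> V \<Longrightarrow> P x = x"
    "\<And>x y. P (x + y) = P x + P y" "\<And>c x. P (c *\<^sub>C x) = c *\<^sub>C P x"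
    using subspace_projection[OF V] by metis
  have Nadd: "N (x + y) \<le> N x + N y" if "x \<in> V" "y \<in> V" for x y
    using N that by (auto simp: is_norm_on_def)
  have Nscale: "N (c *\<^sub>C x) = cmod c * N x" if "x \<in> V" for c x
    using N that by (auto simp: is_norm_on_def)
  have "\<exists>F. (\<forall>x y. F (x + y) = F x + F y) \<and> (\<forall>c x. F (c *\<^sub>C x) = c * F x) \<and>
    (\<forall>x. cmod (F x) \<le> K * N (P x)) \<and> (\<forall>(v, a)\<in>G. F v = a)"
  proof (rule Hahn_Banach_graph_UNIV[OF _ _ ne add scale])
    show "K * N (P (x + y)) \<le> K * N (P x) + K * N (P y)" for x y
      using mult_left_mono[OF Nadd[of "P x" "P y"] K] P by (simp add: distrib_left)
    show "K * N (P (c *\<^sub>C x)) = cmod c * (K * N (P x))" for c x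
      using P by (simp add: Nscale)
    show "cmod a \<le> K * N (P v)" if "(v, a) \<in> G" for v a
      using dom[OF that] GV that P(2) by force
  qed
  then obtain F where F: "\<And>x y. F (x + y) = F x + F y" "\<And>c x. F (c *\<^sub>C x) = c * F x"
    "\<And>x. cmod (F x) \<le> K * N (P x)" "\<forall>(v, a)\<in>G. F v = a"
    by blast
  \<comment> \<open>Cut off outside \<open>V\<close>, as the representation of functionals in
    \<open>dual_space\<close> demands.\<close>
  define F' where "F' x = (if x \<in> V then F x else 0)" for x
  have le: "cmod (F' x) \<le> K * N x" if "x \<in> V" for x
    using F(3)[of x] P(2) that by (simp add: F'_def)
  have "F' \<in> dual_space V N"
    unfolding dual_space_def using le
    by (auto simp: F'_def F complex_vector.subspace_add[OF V] complex_vector.subspace_scale[OF V])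
  moreover have "F' v = a" if "(v, a) \<in> G" for v a
    using F(4) GV that by (force simp: F'_def)
  ultimately show ?thesis using le by (intro bexI[of _ F']) auto
qed

text \<open>Extends the functional sending \<open>c *\<^sub>C x\<close> to \<open>c * N x\<close>
  from the line through \<open>x\<close>. For \<open>x = 0\<close> the graph is the single pair of
  zeros, so this case needs no separate treatment.\<close>

lemma norming_functional:
  fixes V :: "'a::complex_vector set"
  assumes V: "complex_vector.subspace V" and N: "is_norm_on V N" and x: "x \<in> V"
  obtains F where "F \<in> dual_space V N" "\<And>y. y \<in> V \<Longrightarrow> cmod (F y) \<le> N y" "F x = of_real (N x)"
proof -
  define G where "G = (\<lambda>c. (c *\<^sub>C x, c * of_real (N x))) ` UNIV"
  have xG: "(x, of_real (N x)) \<in> G"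
    unfolding G_def by (intro image_eqI[of _ _ 1]) auto
  have "\<exists>F\<in>dual_space V N. (\<forall>x\<in>V. cmod (F x) \<le> 1 * N x) \<and> (\<forall>(v, a)\<in>G. F v = a)"
  proof (rule Hahn_Banach_graph[OF V N])
    show "fst ` G \<subseteq> V" using x by (auto simp: G_def complex_vector.subspace_scale[OF V])
    show "G \<noteq> {}" using xG by auto
    fix v a assume "(v, a) \<in> G"
    then obtain c where c: "v = c *\<^sub>C x" "a = c * of_real (N x)" by (auto simp: G_def)
    show "(d *\<^sub>C v, d * a) \<in> G" for d
      unfolding G_def c by (intro image_eqI[of _ _ "d * c"]) auto
    show "cmod a \<le> 1 * N v" using N x by (auto simp: is_norm_on_def c norm_mult)
    fix w b assume "(w, b) \<in> G"
    then obtain d where d: "w = d *\<^sub>C x" "b = d * of_real (N x)" by (auto simp: G_def)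
    show "(v + w, a + b) \<in> G"
      unfolding G_def c d by (intro image_eqI[of _ _ "c + d"]) (auto simp: algebra_simps)
  qed simp
  then obtain F where "F \<in> dual_space V N" "\<forall>x\<in>V. cmod (F x) \<le> N x" "\<forall>(v, a)\<in>G. F v = a"
    by auto
  then show ?thesis using xG by (intro that[of F]) auto
qed

section \<open>Dual spaces and uniform boundedness\<close>

lemma is_norm_onD:
  assumes "is_norm_on V N"
  shows is_norm_on_nonneg: "x \<in> V \<Longrightarrow> 0 \<le> N x"
    and is_norm_on_eq_0_iff: "x \<in> V \<Longrightarrow> N x = 0 \<longleftrightarrow> x = 0"
    and is_norm_on_scale: "x \<in> V \<Longrightarrow> N (c *\<^sub>C x) = cmod c * N x"
    and is_norm_on_add: "x \<in> V \<Longrightarrow> y \<in> V \<Longrightarrow> N (x + y) \<le> N x + N y"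
  using assms by (auto simp: is_norm_on_def)

lemma is_norm_on_normalize:
  assumes V: "complex_vector.subspace V" and N: "is_norm_on V N" and x: "x \<in> V" "x \<noteq> 0"
  shows "of_real (1 / N x) *\<^sub>C x \<in> V" "N (of_real (1 / N x) *\<^sub>C x) = 1"
proof -
  have "N x > 0" using is_norm_on_nonneg[OF N x(1)] is_norm_on_eq_0_iff[OF N x(1)] x(2) by linarith
  then show "N (of_real (1 / N x) *\<^sub>C x) = 1"
    by (simp add: is_norm_on_scale[OF N x(1)] norm_divide)
qed (rule complex_vector.subspace_scale[OF V x(1)])

text \<open>Rescaling to the unit sphere. The function \<open>h\<close> stands for the modulus of a
  functional or of a form in its first variable. On the trivial space, where the sphere is empty,
  homogeneity at 0 gives the claim.\<close>

lemma le_norm_if_le_on_sphere: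
  fixes h :: "'a::complex_vector \<Rightarrow> real"
  assumes V: "complex_vector.subspace V" and N: "is_norm_on V N"
    and h: "\<And>c x. x \<in> V \<Longrightarrow> h (c *\<^sub>C x) = cmod c * h x"
    and sphere: "\<And>x. x \<in> V \<Longrightarrow> N x = 1 \<Longrightarrow> h x \<le> K" and x: "x \<in> V"
  shows "h x \<le> K * N x"
proof (cases "x = 0")
  case True
  then show ?thesis using h[OF x, of 0] is_norm_on_eq_0_iff[OF N x] by simp
next
  case False
  then have pos: "N x > 0"
    using is_norm_on_nonneg[OF N x(1)] is_norm_on_eq_0_iff[OF N x(1)] by linarith
  have "h (of_real (1 / N x) *\<^sub>C x) \<le> K"
    using is_norm_on_normalize[OF V N x False] by (rule sphere)
  then show ?thesis using pos by (simp add: h[OF x] norm_divide field_simps)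
qed

section \<open>The dual norm and completeness of the dual\<close>

lemma dual_spaceI:
  assumes "\<And>x y. x \<in> V \<Longrightarrow> y \<in> V \<Longrightarrow> f (x + y) = f x + f y"
    and "\<And>c x. x \<in> V \<Longrightarrow> f (c *\<^sub>C x) = c * f x"
    and "\<And>x. x \<in> V \<Longrightarrow> cmod (f x) \<le> C * N x"
    and "\<And>x. x \<notin> V \<Longrightarrow> f x = 0"
  shows "f \<in> dual_space V N"
  using assms unfolding dual_space_def by blast

lemma dual_spaceD:
  assumes "f \<in> dual_space V N"
  shows dual_space_add: "x \<in> V \<Longrightarrow> y \<in> V \<Longrightarrow> f (x + y) = f x + f y"
    and dual_space_scale: "x \<in> V \<Longrightarrow> f (c *\<^sub>C x) = c * f x"
    and dual_space_outside: "x \<notin> V \<Longrightarrow> f x = 0"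
  using assms by (auto simp: dual_space_def)

lemma dual_space_bounded:
  assumes N: "is_norm_on V N" and f: "f \<in> dual_space V N"
  obtains C where "C \<ge> 0" "\<And>x. x \<in> V \<Longrightarrow> cmod (f x) \<le> C * N x"
proof -
  obtain C where C: "\<forall>x\<in>V. cmod (f x) \<le> C * N x" using f by (auto simp: dual_space_def)
  have "cmod (f x) \<le> \<bar>C\<bar> * N x" if "x \<in> V" for x
    using C that mult_right_mono[OF abs_ge_self is_norm_on_nonneg[OF N that], of C] by force
  then show ?thesis by (intro that[of "\<bar>C\<bar>"]) auto
qed

lemma dual_norm_leI:
  assumes V: "complex_vector.subspace V" and N: "is_norm_on V N"
    and le: "\<And>x. x \<in> V \<Longrightarrow> N x \<le> 1 \<Longrightarrow> cmod (f x) \<le> K"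
  shows "dual_norm V N f \<le> K"
proof -
  have "0 \<in> {x\<in>V. N x \<le> 1}"
    using complex_vector.subspace_0[OF V] is_norm_on_eq_0_iff[OF N, of 0] by simp
  then show ?thesis unfolding dual_norm_def by (intro cSUP_least) (auto intro: le)
qed

lemma dual_norm_le_bound:
  assumes V: "complex_vector.subspace V" and N: "is_norm_on V N"
    and le: "\<And>x. x \<in> V \<Longrightarrow> cmod (f x) \<le> K * N x" and K: "K \<ge> 0"
  shows "dual_norm V N f \<le> K"
  by (rule dual_norm_leI[OF V N]) (use le mult_left_mono[OF _ K] in force)

lemma bdd_above_dual_norm:
  assumes N: "is_norm_on V N" and f: "f \<in> dual_space V N"
  shows "bdd_above ((\<lambda>x. cmod (f x)) ` {x\<in>V. N x \<le> 1})"
proof -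
  obtain C where "C \<ge> 0" "\<And>x. x \<in> V \<Longrightarrow> cmod (f x) \<le> C * N x"
    using dual_space_bounded[OF N f] by blast
  then have "cmod (f x) \<le> C" if "x \<in> V" "N x \<le> 1" for x
    using that mult_left_mono[of "N x" 1 C] by force
  then show ?thesis by (intro bdd_aboveI[of _ C]) auto
qed

lemma le_dual_norm:
  assumes V: "complex_vector.subspace V" and N: "is_norm_on V N"
    and f: "f \<in> dual_space V N" and x: "x \<in> V"
  shows "cmod (f x) \<le> dual_norm V N f * N x"
proof (rule le_norm_if_le_on_sphere[OF V N _ _ x])
  show "cmod (f (c *\<^sub>C x)) = cmod c * cmod (f x)" if "x \<in> V" for c x
    using dual_space_scale[OF f that] by (simp add: norm_mult)
  show "cmod (f x) \<le> dual_norm V N f" if "x \<in> V" "N x = 1" for x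
    unfolding dual_norm_def using that by (intro cSUP_upper bdd_above_dual_norm[OF N f]) auto
qed

lemma dual_norm_nonneg:
  assumes V: "complex_vector.subspace V" and N: "is_norm_on V N" and f: "f \<in> dual_space V N"
  shows "0 \<le> dual_norm V N f"
proof -
  have 0: "0 \<in> V" "N 0 = 0"
    using complex_vector.subspace_0[OF V] is_norm_on_eq_0_iff[OF N, of 0] by auto
  then have "cmod (f 0) \<le> dual_norm V N f"
    unfolding dual_norm_def by (intro cSUP_upper bdd_above_dual_norm[OF N f]) auto
  then show ?thesis using norm_ge_zero order_trans by blast
qed

lemma subspace_dual_space:
  assumes V: "complex_vector.subspace V" and N: "is_norm_on V N"
  shows "complex_vector.subspace (dual_space V N)"
proof (rule complex_vector.subspaceI)
  show "0 \<in> dual_space V N" by (rule dual_spaceI[where C = 0]) auto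
next
  fix f g assume f: "f \<in> dual_space V N" and g: "g \<in> dual_space V N"
  show "f + g \<in> dual_space V N"
  proof (rule dual_spaceI)
    show "cmod ((f + g) x) \<le> (dual_norm V N f + dual_norm V N g) * N x" if "x \<in> V" for x
      using le_dual_norm[OF V N f that] le_dual_norm[OF V N g that] norm_triangle_ineq[of "f x" "g x"]
      by (simp add: algebra_simps)
  qed (auto simp: dual_spaceD[OF f] dual_spaceD[OF g] algebra_simps)
next
  fix c f assume f: "f \<in> dual_space V N"
  show "c *\<^sub>C f \<in> dual_space V N"
  proof (rule dual_spaceI)
    show "cmod ((c *\<^sub>C f) x) \<le> (cmod c * dual_norm V N f) * N x" if "x \<in> V" for x
      using mult_left_mono[OF le_dual_norm[OF V N f that], of "cmod c"]
      by (simp add: scaleC_fun_def scaleC_complex_def norm_mult mult.assoc)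
  qed (auto simp: dual_spaceD[OF f] scaleC_fun_def scaleC_complex_def algebra_simps)
qed

lemma is_norm_on_dual_norm:
  assumes V: "complex_vector.subspace V" and N: "is_norm_on V N"
  shows "is_norm_on (dual_space V N) (dual_norm V N)"
  unfolding is_norm_on_def
proof (intro conjI ballI allI)
  fix f assume f: "f \<in> dual_space V N"
  show "0 \<le> dual_norm V N f" by (rule dual_norm_nonneg[OF V N f])
  show "dual_norm V N f = 0 \<longleftrightarrow> f = 0"
  proof
    assume 0: "dual_norm V N f = 0"
    have "f x = 0" for x
      using le_dual_norm[OF V N f, of x] dual_space_outside[OF f, of x] 0 by (cases "x \<in> V") auto
    then show "f = 0" by (simp add: fun_eq_iff)
  next
    assume "f = 0"
    then have "dual_norm V N f \<le> 0" by (intro dual_norm_leI[OF V N]) simp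
    then show "dual_norm V N f = 0" using dual_norm_nonneg[OF V N f] by simp
  qed
  fix g assume g: "g \<in> dual_space V N"
  show "dual_norm V N (f + g) \<le> dual_norm V N f + dual_norm V N g"
  proof (rule dual_norm_le_bound[OF V N])
    show "cmod ((f + g) x) \<le> (dual_norm V N f + dual_norm V N g) * N x" if "x \<in> V" for x
      using le_dual_norm[OF V N f that] le_dual_norm[OF V N g that] norm_triangle_ineq[of "f x" "g x"]
      by (simp add: algebra_simps)
    show "0 \<le> dual_norm V N f + dual_norm V N g"
      using dual_norm_nonneg[OF V N f] dual_norm_nonneg[OF V N g] by simp
  qed
next
  have le: "dual_norm V N (c *\<^sub>C f) \<le> cmod c * dual_norm V N f" if f: "f \<in> dual_space V N" for c f
  proof (rule dual_norm_le_bound[OF V N])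
    show "cmod ((c *\<^sub>C f) x) \<le> (cmod c * dual_norm V N f) * N x" if "x \<in> V" for x
      using mult_left_mono[OF le_dual_norm[OF V N f that], of "cmod c"]
      by (simp add: scaleC_fun_def scaleC_complex_def norm_mult mult.assoc)
    show "0 \<le> cmod c * dual_norm V N f" using dual_norm_nonneg[OF V N f] by simp
  qed
  fix c f assume f: "f \<in> dual_space V N"
  have cf: "c *\<^sub>C f \<in> dual_space V N"
    by (rule complex_vector.subspace_scale[OF subspace_dual_space[OF V N] f])
  show "dual_norm V N (c *\<^sub>C f) = cmod c * dual_norm V N f"
  proof (rule antisym[OF le[OF f]])
    show "cmod c * dual_norm V N f \<le> dual_norm V N (c *\<^sub>C f)"
    proof (cases "c = 0")
      case True
      then show ?thesis using dual_norm_nonneg[OF V N cf] by simp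
    next
      case False
      \<comment> \<open>The inequality already proved, applied to \<open>inverse c\<close> and
        \<open>c *\<^sub>C f\<close>, gives the reverse one.\<close>
      then show ?thesis using le[OF cf, of "inverse c"] by (simp add: norm_divide field_simps)
    qed
  qed
qed

text \<open>The limit is taken pointwise; the Cauchy estimates, uniform relative to
  \<open>N x\<close>, survive the passage to the limit. Completeness of the dual allows uniform
  boundedness to be applied to families of functionals on it.\<close>

lemma is_banach_on_dual_space:
  assumes V: "complex_vector.subspace V" and N: "is_norm_on V N"
  shows "is_banach_on (dual_space V N) (dual_norm V N)"
  unfolding is_banach_on_def
proof (intro conjI allI impI)
  let ?E = "dual_space V N" and ?M = "dual_norm V N"
  note E = subspace_dual_space[OF V N]
  show "complex_vector.subspace ?E" by (rule E)
  show "is_norm_on ?E ?M" by (rule is_norm_on_dual_norm[OF V N])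
  fix X assume X: "(\<forall>n. X n \<in> ?E) \<and> Cauchy_wrt ?M X"
  then have XE: "X n \<in> ?E" for n by blast
  have diff: "cmod (X m x - X n x) \<le> ?M (X m - X n) * N x" if "x \<in> V" for m n x
    using le_dual_norm[OF V N complex_vector.subspace_diff[OF E XE XE] that] by simp
  have unif: "\<exists>k. \<forall>m\<ge>k. \<forall>n\<ge>k. \<forall>x\<in>V. cmod (X m x - X n x) \<le> e * N x" if e: "e > 0" for e
  proof -
    obtain k where k: "\<forall>m\<ge>k. \<forall>n\<ge>k. ?M (X m - X n) < e"
      using X e unfolding Cauchy_wrt_def by blast
    have "cmod (X m x - X n x) \<le> e * N x" if "m \<ge> k" "n \<ge> k" "x \<in> V" for m n x
      using diff[of x m n] mult_right_mono[of "?M (X m - X n)" e "N x"] k that e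
        is_norm_on_nonneg[OF N, of x] by fastforce
    then show ?thesis by blast
  qed
  have "convergent (\<lambda>n. X n x)" for x
  proof (cases "x \<in> V")
    case False
    then show ?thesis using dual_space_outside[OF XE] by (simp add: convergent_const)
  next
    case True
    then have nonneg: "N x \<ge> 0" by (rule is_norm_on_nonneg[OF N])
    have "Cauchy (\<lambda>n. X n x)"
    proof (rule CauchyI)
      fix e :: real assume e: "e > 0"
      \<comment> \<open>Adding 1 avoids division by zero and leaves room for the strict
        inequality.\<close>
      then have "e / (N x + 1) > 0" using nonneg by simp
      then obtain k where k: "\<forall>m\<ge>k. \<forall>n\<ge>k. \<forall>x'\<in>V. cmod (X m x' - X n x') \<le> e / (N x + 1) * N x'"
        using unif by blast
      have "e / (N x + 1) * N x < e" using e nonneg by (simp add: field_simps)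
      then show "\<exists>k. \<forall>m\<ge>k. \<forall>n\<ge>k. norm (X m x - X n x) < e"
        using k True by (intro exI[of _ k]) (meson le_less_trans)
    qed
    then show ?thesis by (simp add: Cauchy_convergent_iff)
  qed
  then obtain l where l: "(\<lambda>n. X n x) \<longlonglongrightarrow> l x" for x
    unfolding convergent_def by metis
  have lim: "\<exists>k. \<forall>n\<ge>k. \<forall>x\<in>V. cmod (X n x - l x) \<le> e * N x" if e: "e > 0" for e
  proof -
    obtain k where k: "\<forall>m\<ge>k. \<forall>n\<ge>k. \<forall>x\<in>V. cmod (X m x - X n x) \<le> e * N x"
      using unif[OF e] by blast
    have "cmod (X n x - l x) \<le> e * N x" if "n \<ge> k" "x \<in> V" for n x
    \<comment> \<open>The Cauchy estimate for \<open>n\<close> fixed and \<open>m\<close> tending to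
      infinity.\<close>
    proof (rule LIMSEQ_le_const2)
      show "(\<lambda>m. cmod (X n x - X m x)) \<longlonglongrightarrow> cmod (X n x - l x)"
        by (intro tendsto_intros l)
      show "\<exists>N'. \<forall>m\<ge>N'. cmod (X n x - X m x) \<le> e * N x" using k that by blast
    qed
    then show ?thesis by blast
  qed
  have lE: "l \<in> ?E"
  proof -
    obtain n where n: "\<forall>x\<in>V. cmod (X n x - l x) \<le> 1 * N x" using lim[of 1] by auto
    show ?thesis
    proof (rule dual_spaceI)
      show "l (x + y) = l x + l y" if "x \<in> V" "y \<in> V" for x y
      proof (rule LIMSEQ_unique[OF l])
        show "(\<lambda>n. X n (x + y)) \<longlonglongrightarrow> l x + l y"
          using tendsto_add[OF l[of x] l[of y]] dual_space_add[OF XE that] by simp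
      qed
      show "l (c *\<^sub>C x) = c * l x" if "x \<in> V" for c x
      proof (rule LIMSEQ_unique[OF l])
        show "(\<lambda>n. X n (c *\<^sub>C x)) \<longlonglongrightarrow> c * l x"
          using tendsto_mult_left[OF l[of x], of c] dual_space_scale[OF XE that] by simp
      qed
      show "cmod (l x) \<le> (?M (X n) + 1) * N x" if "x \<in> V" for x
      proof -
        have "cmod (l x) \<le> cmod (X n x) + cmod (X n x - l x)"
          by (metis norm_minus_commute norm_triangle_sub)
        then show ?thesis
          using n that le_dual_norm[OF V N XE that, of n] by (fastforce simp: algebra_simps)
      qed
      show "l x = 0" if "x \<notin> V" for x
        using l[of x] dual_space_outside[OF XE that] by (simp add: LIMSEQ_const_iff)
    qed
  qed
  have "(\<lambda>n. ?M (X n - l)) \<longlonglongrightarrow> 0"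
  proof (rule LIMSEQ_I)
    fix r :: real assume r: "r > 0"
    then obtain k where k: "\<forall>n\<ge>k. \<forall>x\<in>V. cmod (X n x - l x) \<le> r / 2 * N x"
      using lim[of "r / 2"] by auto
    have "norm (?M (X n - l) - 0) < r" if n: "n \<ge> k" for n
    proof -
      have "?M (X n - l) \<le> r / 2"
        by (rule dual_norm_le_bound[OF V N]) (use k n r in auto)
      moreover have "0 \<le> ?M (X n - l)"
        by (rule dual_norm_nonneg[OF V N complex_vector.subspace_diff[OF E XE lE]])
      ultimately show ?thesis using r by simp
    qed
    then show "\<exists>k. \<forall>n\<ge>k. norm (?M (X n - l) - 0) < r" by blast
  qed
  then show "\<exists>l\<in>?E. (\<lambda>n. ?M (X n - l)) \<longlonglongrightarrow> 0" using lE by blast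
qed

text \<open>Sokal's argument: \<open>x\<close> is the limit of partial sums of \<open>\<plusminus> v n\<close>, where \<open>N (v n) \<le> 3^-n\<close>,
  \<open>v n\<close> nearly norms the \<open>n\<close>-th functional, and the sign prevents cancellation.\<close>
lemma uniform_boundedness:
  assumes B: "is_banach_on V N" and \<Phi>: "\<Phi> \<subseteq> dual_space V N"
    and pointwise: "\<And>x. x \<in> V \<Longrightarrow> \<exists>K. \<forall>f\<in>\<Phi>. cmod (f x) \<le> K"
  shows "\<exists>K. \<forall>f\<in>\<Phi>. dual_norm V N f \<le> K"
proof (rule ccontr)
  assume unbounded: "\<not> ?thesis"
  have V: "complex_vector.subspace V" and N: "is_norm_on V N"
    using B by (auto simp: is_banach_on_def)
  \<comment> \<open>Norms above \<open>4 ^ n\<close> beat the radii \<open>(1/3) ^ n\<close>, and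
    the factor 3/4 exceeds the 1/2 that the tail of the series will cost.\<close>
  have "\<exists>f v. f \<in> \<Phi> \<and> dual_norm V N f > 4 ^ n \<and> v \<in> V \<and> N v \<le> (1/3) ^ n \<and>
      cmod (f v) > 3/4 * dual_norm V N f * (1/3) ^ n" for n :: nat
  proof -
    obtain f where f: "f \<in> \<Phi>" "dual_norm V N f > 4 ^ n"
      using unbounded by (meson not_le)
    then have pos: "dual_norm V N f > 0" by (meson le_less_trans zero_le_numeral zero_le_power)
    have "\<exists>x\<in>V. N x \<le> 1 \<and> cmod (f x) > 3/4 * dual_norm V N f"
    proof (rule ccontr)
      assume "\<not> ?thesis"
      then have "dual_norm V N f \<le> 3/4 * dual_norm V N f"
        by (intro dual_norm_leI[OF V N]) force
      then show False using pos by simp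
    qed
    then obtain x where x: "x \<in> V" "N x \<le> 1" "cmod (f x) > 3/4 * dual_norm V N f" by blast
    define v where "v = of_real ((1/3) ^ n) *\<^sub>C x"
    have "v \<in> V" unfolding v_def by (rule complex_vector.subspace_scale[OF V x(1)])
    moreover have "N v \<le> (1/3) ^ n"
      using x(2) by (simp add: v_def is_norm_on_scale[OF N x(1)] norm_power norm_divide mult_left_le)
    moreover have "f v = of_real ((1/3) ^ n) * f x"
      unfolding v_def using f(1) \<Phi> dual_space_scale[OF _ x(1)] by blast
    then have "cmod (f v) = (1/3) ^ n * cmod (f x)"
      by (simp add: norm_mult norm_power norm_divide)
    then have "cmod (f v) > 3/4 * dual_norm V N f * (1/3) ^ n"
      using x(3) mult_strict_left_mono[OF x(3), of "(1/3) ^ n"] by (simp add: mult.commute)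
    ultimately show ?thesis using f by blast
  qed
  then obtain f v where f\<Phi>: "\<And>n. f n \<in> \<Phi>" and f_large: "\<And>n. dual_norm V N (f n) > 4 ^ n"
    and v: "\<And>n. v n \<in> V" and Nv: "\<And>n. N (v n) \<le> (1/3) ^ n"
    and fv: "\<And>n. cmod (f n (v n)) > 3/4 * dual_norm V N (f n) * (1/3) ^ n"
    by metis
  have f: "f n \<in> dual_space V N" for n using f\<Phi> \<Phi> by blast
  note Vadd = complex_vector.subspace_add[OF V] and Vdiff = complex_vector.subspace_diff[OF V]
  have Nminus: "N (- x) = N x" if "x \<in> V" for x
    using is_norm_on_scale[OF N that, of "-1"] by simp
  define X where "X = rec_nat 0
    (\<lambda>n x. if cmod (f n (x + v n)) \<ge> cmod (f n (v n)) then x + v n else x - v n)"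
  have X0: "X 0 = 0" and XSuc: "X (Suc n) =
    (if cmod (f n (X n + v n)) \<ge> cmod (f n (v n)) then X n + v n else X n - v n)" for n
    by (simp_all add: X_def)
  have XV: "X n \<in> V" for n
    by (induction n) (auto simp: X0 XSuc v Vadd Vdiff complex_vector.subspace_0[OF V])
  have f_diff: "f n (x - y) = f n x - f n y" if "x \<in> V" "y \<in> V" for n x y
    using dual_space_add[OF f Vdiff[OF that] that(2), of n] by simp
  have fX: "cmod (f n (X (Suc n))) \<ge> cmod (f n (v n))" for n
  proof (cases "cmod (f n (X n + v n)) \<ge> cmod (f n (v n))")
    case False
    \<comment> \<open>The values of \<open>f n\<close> at \<open>X n + v n\<close> and
      \<open>X n - v n\<close> differ by \<open>2 * f n (v n)\<close>, so one of them has modulus at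
      least that of \<open>f n (v n)\<close>.\<close>
    have "2 * cmod (f n (v n)) = cmod (f n (X n + v n) - f n (X n - v n))"
      using dual_space_add[OF f XV v, of n n n] f_diff[OF XV v, of n n n]
      by (simp add: norm_mult flip: mult_2)
    also have "\<dots> \<le> cmod (f n (X n + v n)) + cmod (f n (X n - v n))"
      by (rule norm_triangle_ineq4)
    finally show ?thesis using False by (simp add: XSuc)
  qed (simp add: XSuc)
  \<comment> \<open>Summing these steps from \<open>n\<close> on gives a geometric series with sum
    \<open>3/2 * (1/3) ^ n\<close>.\<close>
  have step: "N (X (Suc n) - X n) \<le> (1/3) ^ n" for n
    using Nv[of n] Nminus[OF v, of n] by (simp add: XSuc)
  have tail: "N (X (n + k) - X n) \<le> 3/2 * (1/3) ^ n * (1 - (1/3) ^ k)" for n k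
  proof (induction k)
    case 0
    then show ?case using is_norm_on_eq_0_iff[OF N complex_vector.subspace_0[OF V]] by simp
  next
    case (Suc k)
    have "N (X (n + Suc k) - X n) \<le> N (X (Suc (n + k)) - X (n + k)) + N (X (n + k) - X n)"
      using is_norm_on_add[OF N Vdiff[OF XV XV] Vdiff[OF XV XV], of "Suc (n + k)" "n + k" "n + k" n]
      by simp
    also have "\<dots> \<le> (1/3) ^ (n + k) + 3/2 * (1/3) ^ n * (1 - (1/3) ^ k)"
      using step[of "n + k"] Suc.IH by simp
    also have "\<dots> = 3/2 * (1/3) ^ n * (1 - (1/3) ^ Suc k)"
      by (simp add: power_add field_simps)
    finally show ?case .
  qed
  have tail': "N (X m - X n) \<le> 3/2 * (1/3) ^ n" if "m \<ge> n" for m n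
  proof -
    have "N (X (n + (m - n)) - X n) \<le> 3/2 * (1/3) ^ n * 1"
      by (rule order_trans[OF tail mult_left_mono]) auto
    then show ?thesis using that by simp
  qed
  have "Cauchy_wrt N X"
    unfolding Cauchy_wrt_def
  proof (intro allI impI)
    fix e :: real assume e: "e > 0"
    have "(\<lambda>n. 3/2 * (1/3 :: real) ^ n) \<longlonglongrightarrow> 3/2 * 0"
      by (intro tendsto_intros LIMSEQ_power_zero) simp
    then have "\<forall>\<^sub>F n in sequentially. 3/2 * (1/3 :: real) ^ n < e"
      using order_tendstoD(2) e by fastforce
    then obtain k where k: "\<forall>n\<ge>k. 3/2 * (1/3 :: real) ^ n < e"
      by (auto simp: eventually_sequentially)
    have "N (X n - X m) < e" if "m \<ge> k" "n \<ge> k" for m n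
    proof (cases "m \<le> n")
      case True
      then show ?thesis using tail'[OF True] k that by force
    next
      case False
      then have "N (X m - X n) < e" using tail'[of n m] k that by force
      then show ?thesis using Nminus[OF Vdiff[OF XV XV], of m n] by simp
    qed
    then show "\<exists>k. \<forall>m\<ge>k. \<forall>n\<ge>k. N (X n - X m) < e" by blast
  qed
  then obtain x where x: "x \<in> V" and lim: "(\<lambda>n. N (X n - x)) \<longlonglongrightarrow> 0"
    using B XV unfolding is_banach_on_def by blast
  have close: "N (X n - x) \<le> 3/2 * (1/3) ^ n" for n
  proof -
    have "N (X n - x) \<le> 3/2 * (1/3) ^ n + N (X m - x)" if "m \<ge> n" for m
      using is_norm_on_add[OF N Vdiff[OF XV XV] Vdiff[OF XV x], of n m m]
        Nminus[OF Vdiff[OF XV XV], of m n] tail'[OF that] by simp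
    moreover have "(\<lambda>m. 3/2 * (1/3) ^ n + N (X m - x)) \<longlonglongrightarrow> 3/2 * (1/3) ^ n + 0"
      by (intro tendsto_intros lim)
    ultimately have "N (X n - x) \<le> 3/2 * (1/3) ^ n + 0"
      by (intro LIMSEQ_le_const[where X = "\<lambda>m. 3/2 * (1/3) ^ n + N (X m - x)"]) blast+
    then show ?thesis by simp
  qed
  obtain K where K: "\<And>g. g \<in> \<Phi> \<Longrightarrow> cmod (g x) \<le> K" using pointwise[OF x] by blast
  \<comment> \<open>Comparison with \<open>X (Suc n)\<close>, the first sum containing
    \<open>v n\<close>: its distance to \<open>x\<close> is at most \<open>1/2 * (1/3) ^ n\<close>,
    so of the fraction 3/4 of the dual norm at least 1/4 remains at \<open>x\<close>.\<close>
  have large: "1/4 * (4/3) ^ n \<le> K" for n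
  proof -
    have "cmod (f n (X (Suc n)) - f n x) \<le> dual_norm V N (f n) * N (X (Suc n) - x)"
      using le_dual_norm[OF V N f Vdiff[OF XV x], of n "Suc n"] f_diff[OF XV x, of n "Suc n"] by simp
    also have "\<dots> \<le> dual_norm V N (f n) * (3/2 * (1/3) ^ Suc n)"
      by (intro mult_left_mono close dual_norm_nonneg[OF V N f])
    finally have diff: "cmod (f n (X (Suc n)) - f n x) \<le> 1/2 * dual_norm V N (f n) * (1/3) ^ n"
      by (simp add: mult_ac)
    have "(1/4 :: real) * (4/3) ^ n = 1/4 * 4 ^ n * (1/3) ^ n"
      by (simp add: power_divide)
    also have "\<dots> \<le> 1/4 * dual_norm V N (f n) * (1/3) ^ n"
      using f_large[of n] by (intro mult_right_mono mult_left_mono) auto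
    also have "\<dots> \<le> cmod (f n x)"
      using norm_triangle_ineq2[of "f n (X (Suc n))" "f n x"] diff fX[of n] fv[of n] by simp
    also have "\<dots> \<le> K" by (rule K[OF f\<Phi>])
    finally show ?thesis .
  qed
  obtain n where "4 * K < (4/3) ^ n" using real_arch_pow[of "4/3" "4 * K"] by auto
  then show False using large[of n] by simp
qed

section \<open>Bounded forms on a reflexive space\<close>

text \<open>The adjoint form is a second instance with the same data, so each result about one
  variable of the form can be transferred to the other.\<close>

locale reflexive_form =
  fixes D :: "'h::complex_vector set" and N :: "'h \<Rightarrow> real" and B :: "'h \<Rightarrow> 'h \<Rightarrow> complex" and M :: real
  assumes reflexive: "is_reflexive_banach_on D N"
    and sesquilinear: "sesquilinear_on D B"
    and bounded: "\<And>x y. x \<in> D \<Longrightarrow> y \<in> D \<Longrightarrow> cmod (B x y) \<le> M * N x * N y"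
begin

lemma D: "complex_vector.subspace D" and N: "is_norm_on D N"
  using reflexive by (auto simp: is_reflexive_banach_on_def is_banach_on_def)

lemmas D_add = complex_vector.subspace_add[OF D]
  and D_scale = complex_vector.subspace_scale[OF D]

lemma B_add_left: "x \<in> D \<Longrightarrow> y \<in> D \<Longrightarrow> z \<in> D \<Longrightarrow> B (x + y) z = B x z + B y z"
  and B_scale_left: "x \<in> D \<Longrightarrow> z \<in> D \<Longrightarrow> B (c *\<^sub>C x) z = c * B x z"
  and B_add_right: "x \<in> D \<Longrightarrow> y \<in> D \<Longrightarrow> z \<in> D \<Longrightarrow> B x (y + z) = B x y + B x z"
  and B_scale_right: "x \<in> D \<Longrightarrow> z \<in> D \<Longrightarrow> B x (c *\<^sub>C z) = cnj c * B x z"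
  using sesquilinear by (auto simp: sesquilinear_on_def)

lemma reflexive_form_adjoint: "reflexive_form D N (adjoint_form B) M"
proof
  show "is_reflexive_banach_on D N" by (rule reflexive)
  show "sesquilinear_on D (adjoint_form B)"
    by (simp add: sesquilinear_on_def adjoint_form_def B_add_left B_scale_left B_add_right B_scale_right)
  show "cmod (adjoint_form B x y) \<le> M * N x * N y" if "x \<in> D" "y \<in> D" for x y
    using bounded[OF that(2,1)] by (simp add: adjoint_form_def mult_ac)
qed

section \<open>Lower bounds in the second variable\<close>

text \<open>Statement (d) without suprema: every positive bound \<open>K\<close> of \<open>B\<close>
  in its first variable must dominate \<open>c * N y\<close>. This avoids \<open>ennreal\<close> and
  the empty sphere; the value \<open>K = 0\<close> is reached by approximation.\<close>

definition bounded_below :: "real \<Rightarrow> bool" where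
  "bounded_below c \<longleftrightarrow> (\<forall>y\<in>D. \<forall>K>0. (\<forall>x\<in>D. cmod (B x y) \<le> K * N x) \<longrightarrow> c * N y \<le> K)"

lemma sphere_sup_left_le_iff:
  assumes y: "y \<in> D" and K: "K \<ge> 0"
  shows "sphere_sup_left D N B y \<le> ennreal K \<longleftrightarrow> (\<forall>x\<in>D. cmod (B x y) \<le> K * N x)"
proof
  assume "sphere_sup_left D N B y \<le> ennreal K"
  then have "cmod (B x y) \<le> K" if "x \<in> D" "N x = 1" for x
    using that K by (simp add: sphere_sup_left_def SUP_le_iff)
  then show "\<forall>x\<in>D. cmod (B x y) \<le> K * N x"
    using le_norm_if_le_on_sphere[OF D N, of "\<lambda>x. cmod (B x y)" K] y
    by (simp add: B_scale_left norm_mult)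
next
  assume "\<forall>x\<in>D. cmod (B x y) \<le> K * N x"
  then show "sphere_sup_left D N B y \<le> ennreal K"
    unfolding sphere_sup_left_def by (intro SUP_least ennreal_leI) fastforce
qed

lemma sphere_sup_left_finite:
  assumes y: "y \<in> D"
  obtains s where "s \<ge> 0" "sphere_sup_left D N B y = ennreal s"
proof -
  \<comment> \<open>The sign of \<open>M\<close> is not fixed, whereas the criterion above takes a
    nonnegative constant.\<close>
  have "cmod (B x y) \<le> \<bar>M * N y\<bar> * N x" if x: "x \<in> D" for x
    using bounded[OF x y] mult_right_mono[OF abs_ge_self[of "M * N y"] is_norm_on_nonneg[OF N x]]
    by (simp add: mult_ac)
  then have "sphere_sup_left D N B y \<le> ennreal \<bar>M * N y\<bar>"
    by (simp add: sphere_sup_left_le_iff[OF y])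
  then have "sphere_sup_left D N B y < top"
    by (rule le_less_trans) (rule ennreal_less_top)
  then show ?thesis
    using that[OF enn2real_nonneg, of "sphere_sup_left D N B y"] by simp
qed

lemma bounded_below_iff:
  assumes c: "c > 0"
  shows "bounded_below c \<longleftrightarrow> (\<forall>y\<in>D. ennreal (c * N y) \<le> sphere_sup_left D N B y)"
proof
  assume below: "bounded_below c"
  show "\<forall>y\<in>D. ennreal (c * N y) \<le> sphere_sup_left D N B y"
  proof
    fix y assume y: "y \<in> D"
    obtain s where s: "s \<ge> 0" "sphere_sup_left D N B y = ennreal s"
      using sphere_sup_left_finite[OF y] .
    \<comment> \<open>The supremum \<open>s\<close> may be 0, while \<open>bounded_below\<close>
      speaks of positive bounds; hence the slack \<open>e\<close>.\<close>
    have "c * N y \<le> s + e" if e: "e > 0" for e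
    proof -
      have "sphere_sup_left D N B y \<le> ennreal (s + e)" using s e by (simp add: ennreal_leI)
      then have "\<forall>x\<in>D. cmod (B x y) \<le> (s + e) * N x"
        using s e sphere_sup_left_le_iff[OF y, of "s + e"] by simp
      moreover have "s + e > 0" using s e by simp
      ultimately show ?thesis using below y unfolding bounded_below_def by blast
    qed
    then have "c * N y \<le> s" by (rule field_le_epsilon)
    then show "ennreal (c * N y) \<le> sphere_sup_left D N B y" using s by (simp add: ennreal_leI)
  qed
next
  assume *: "\<forall>y\<in>D. ennreal (c * N y) \<le> sphere_sup_left D N B y"
  show "bounded_below c"
    unfolding bounded_below_def
  proof (intro ballI allI impI)
    fix y K assume y: "y \<in> D" and K: "K > (0::real)" and "\<forall>x\<in>D. cmod (B x y) \<le> K * N x"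
    then have "sphere_sup_left D N B y \<le> ennreal K" using sphere_sup_left_le_iff[OF y, of K] by simp
    then have "ennreal (c * N y) \<le> ennreal K" using * y by (meson order_trans)
    then show "c * N y \<le> K" using K by simp
  qed
qed

text \<open>If no constant works, each \<open>1 / Suc n\<close> fails at some vector; after
  normalization these vectors have norm 1 while their suprema tend to 0. The other direction is a
  sandwich argument.\<close>

lemma bounded_below_iff_sequential:
  "(\<exists>c>0. bounded_below c) \<longleftrightarrow> (\<forall>y::nat \<Rightarrow> 'h. (\<forall>n. y n \<in> D) \<longrightarrow>
     (\<lambda>n. sphere_sup_left D N B (y n)) \<longlonglongrightarrow> 0 \<longrightarrow> (\<lambda>n. N (y n)) \<longlonglongrightarrow> 0)"
    (is "?L \<longleftrightarrow> ?R")
proof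
  assume ?L
  then obtain c where c: "c > 0" and below: "\<And>y. y \<in> D \<Longrightarrow> ennreal (c * N y) \<le> sphere_sup_left D N B y"
    using bounded_below_iff by blast
  show ?R
  proof (intro allI impI)
    fix y :: "nat \<Rightarrow> 'h" assume y: "\<forall>n. y n \<in> D" and lim: "(\<lambda>n. sphere_sup_left D N B (y n)) \<longlonglongrightarrow> 0"
    have "(\<lambda>n. ennreal (c * N (y n))) \<longlonglongrightarrow> 0"
      by (rule tendsto_sandwich[OF _ _ tendsto_const lim]) (use y below in auto)
    then have "(\<lambda>n. ennreal (c * N (y n))) \<longlonglongrightarrow> ennreal 0" by simp
    then have "(\<lambda>n. c * N (y n)) \<longlonglongrightarrow> 0"
      by (rule tendsto_ennrealD) (use y c is_norm_on_nonneg[OF N] in auto)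
    then have "(\<lambda>n. 1 / c * (c * N (y n))) \<longlonglongrightarrow> 1 / c * 0" by (rule tendsto_mult_left)
    then show "(\<lambda>n. N (y n)) \<longlonglongrightarrow> 0" using c by simp
  qed
next
  assume R: ?R
  show ?L
  proof (rule ccontr)
    assume not: "\<not> ?L"
    have "\<exists>y. y \<in> D \<and> N y = 1 \<and> sphere_sup_left D N B y \<le> ennreal (1 / Suc n)" for n :: nat
    proof -
      have "\<not> bounded_below (1 / Suc n)" using not by simp
      then obtain y K where y: "y \<in> D" and K: "K > 0" "\<And>x. x \<in> D \<Longrightarrow> cmod (B x y) \<le> K * N x"
        and less: "K < 1 / Suc n * N y"
        unfolding bounded_below_def by force
      then have pos: "N y > 0" by (smt (verit) mult_nonneg_nonpos of_nat_0_le_iff divide_nonneg_nonneg)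
      then have "y \<noteq> 0" using is_norm_on_eq_0_iff[OF N y] by auto
      note norm = is_norm_on_normalize[OF D N y this]
      have "cmod (B x (of_real (1 / N y) *\<^sub>C y)) \<le> 1 / Suc n * N x" if x: "x \<in> D" for x
      proof -
        have "cmod (B x (of_real (1 / N y) *\<^sub>C y)) \<le> (K / N y) * N x"
          using K(2)[OF x] pos by (simp add: B_scale_right[OF x y] norm_mult norm_divide divide_right_mono)
        also have "\<dots> \<le> 1 / Suc n * N x"
          using less pos by (intro mult_right_mono is_norm_on_nonneg[OF N x]) (simp add: field_simps)
        finally show ?thesis .
      qed
      then show ?thesis using norm sphere_sup_left_le_iff[OF norm(1), of "1 / Suc n"] by auto
    qed
    then obtain y where y: "\<And>n. y n \<in> D" "\<And>n. N (y n) = 1"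
      "\<And>n. sphere_sup_left D N B (y n) \<le> ennreal (1 / Suc n)" by metis
    have "(\<lambda>n. ennreal (1 / Suc n)) \<longlonglongrightarrow> ennreal 0"
      by (intro tendsto_ennrealI LIMSEQ_Suc[OF lim_1_over_n])
    then have "(\<lambda>n. sphere_sup_left D N B (y n)) \<longlonglongrightarrow> 0"
      by (intro tendsto_sandwich[OF _ _ tendsto_const, of _ "\<lambda>n. sphere_sup_left D N B (y n)"]) (use y in auto)
    then have "(\<lambda>n. N (y n)) \<longlonglongrightarrow> 0" using R y by blast
    then show False by (simp add: y LIMSEQ_const_iff)
  qed
qed

definition represents :: "'h \<Rightarrow> ('h \<Rightarrow> complex) \<Rightarrow> bool" where
  "represents x \<Lambda> \<longleftrightarrow> x \<in> D \<and> (\<forall>y\<in>D. \<Lambda> y = B x y)"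

section \<open>Representation of conjugate linear functionals\<close>

text \<open>The extension argument in quantitative form: the constant \<open>C / c\<close> passes
  from the graph to \<open>F\<close> and from there to the representing vector. The bound on
  \<open>N x\<close> later yields the lower bound for the adjoint form.\<close>

lemma represents_if_bounded_below:
  assumes c: "c > 0" and below: "bounded_below c"
    and \<Lambda>: "\<And>x y. x \<in> D \<Longrightarrow> y \<in> D \<Longrightarrow> \<Lambda> (x + y) = \<Lambda> x + \<Lambda> y"
      "\<And>a x. x \<in> D \<Longrightarrow> \<Lambda> (a *\<^sub>C x) = cnj a * \<Lambda> x"
      "\<And>x. x \<in> D \<Longrightarrow> cmod (\<Lambda> x) \<le> C * N x"
    and C: "C \<ge> 0"
  obtains x where "represents x \<Lambda>" "N x \<le> C / c"
proof -
  let ?E = "dual_space D N" and ?M = "dual_norm D N"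
  define S where "S y = (\<lambda>x. if x \<in> D then B x y else 0)" for y
  have SE: "S y \<in> ?E" if y: "y \<in> D" for y
    by (rule dual_spaceI[where C = "M * N y"])
      (use y bounded D_add D_scale in \<open>auto simp: S_def B_add_left B_scale_left mult_ac\<close>)
  have S_below: "c * N y \<le> ?M (S y)" if y: "y \<in> D" for y
  proof (rule field_le_epsilon)
    fix e :: real assume e: "e > 0"
    have "cmod (B x y) \<le> (?M (S y) + e) * N x" if x: "x \<in> D" for x
    proof -
      have "cmod (B x y) \<le> ?M (S y) * N x"
        using le_dual_norm[OF D N SE[OF y] x] x by (simp add: S_def)
      moreover have "e * N x \<ge> 0" using e is_norm_on_nonneg[OF N x] by simp
      ultimately show ?thesis by (simp add: distrib_right)
    qed
    moreover have "?M (S y) + e > 0" using dual_norm_nonneg[OF D N SE[OF y]] e by simp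
    ultimately show "c * N y \<le> ?M (S y) + e" using below y unfolding bounded_below_def by blast
  qed
  \<comment> \<open>Both components depend on \<open>y\<close> in a conjugate linear way, so the
    graph is a complex subspace: multiplication by \<open>b\<close> corresponds to replacing
    \<open>y\<close> by \<open>cnj b *\<^sub>C y\<close>.\<close>
  define G where "G = (\<lambda>y. (S y, \<Lambda> y)) ` D"
  have "\<exists>F\<in>dual_space ?E ?M. (\<forall>f\<in>?E. cmod (F f) \<le> C / c * ?M f) \<and> (\<forall>(f, a)\<in>G. F f = a)"
  proof (rule Hahn_Banach_graph[OF subspace_dual_space[OF D N] is_norm_on_dual_norm[OF D N]])
    show "C / c \<ge> 0" using C c by simp
    show "fst ` G \<subseteq> ?E" using SE by (auto simp: G_def)
    show "G \<noteq> {}" using complex_vector.subspace_0[OF D] by (auto simp: G_def)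
    fix f a assume "(f, a) \<in> G"
    then obtain y where y: "y \<in> D" "f = S y" "a = \<Lambda> y" by (auto simp: G_def)
    show "(b *\<^sub>C f, b * a) \<in> G" for b
      unfolding G_def
    proof (rule image_eqI)
      show "cnj b *\<^sub>C y \<in> D" by (rule D_scale[OF y(1)])
      show "(b *\<^sub>C f, b * a) = (S (cnj b *\<^sub>C y), \<Lambda> (cnj b *\<^sub>C y))"
        using y by (auto simp: S_def \<Lambda> B_scale_right scaleC_fun_def scaleC_complex_def)
    qed
    have "cmod (\<Lambda> y) \<le> C / c * (c * N y)" using \<Lambda>(3)[OF y(1)] c by simp
    also have "\<dots> \<le> C / c * ?M (S y)" using S_below[OF y(1)] C c by (intro mult_left_mono) auto
    finally show "cmod a \<le> C / c * ?M f" by (simp add: y)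
    fix g b assume "(g, b) \<in> G"
    then obtain z where z: "z \<in> D" "g = S z" "b = \<Lambda> z" by (auto simp: G_def)
    show "(f + g, a + b) \<in> G"
      unfolding G_def
    proof (rule image_eqI)
      show "y + z \<in> D" by (rule D_add[OF y(1) z(1)])
      show "(f + g, a + b) = (S (y + z), \<Lambda> (y + z))"
        using y z by (auto simp: S_def \<Lambda> B_add_right)
    qed
  qed
  then obtain F where F: "F \<in> dual_space ?E ?M" "\<forall>f\<in>?E. cmod (F f) \<le> C / c * ?M f"
    "\<forall>(f, a)\<in>G. F f = a" by blast
  then obtain x where x: "x \<in> D" "\<And>f. f \<in> ?E \<Longrightarrow> F f = f x"
    using reflexive unfolding is_reflexive_banach_on_def by blast
  have "\<Lambda> y = B x y" if y: "y \<in> D" for y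
    using F(3) x SE[OF y] y by (force simp: G_def S_def)
  then have "represents x \<Lambda>" using x(1) by (simp add: represents_def)
  moreover have "N x \<le> C / c"
  proof -
    \<comment> \<open>A functional norming \<open>x\<close> turns the bound on \<open>F\<close> into
      one on \<open>x\<close>: \<open>F f\<close> equals \<open>N x\<close>, and the dual norm of
      \<open>f\<close> is at most 1.\<close>
    obtain f where f: "f \<in> ?E" "\<And>y. y \<in> D \<Longrightarrow> cmod (f y) \<le> N y" "f x = of_real (N x)"
      using norming_functional[OF D N x(1)] by blast
    have "?M f \<le> 1" by (rule dual_norm_leI[OF D N]) (use f(2) in force)
    then have "C / c * ?M f \<le> C / c" using C c by (intro mult_left_le) auto
    moreover have "cmod (f x) \<le> C / c * ?M f" using F(2) x(2) f(1) by metis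
    ultimately show ?thesis using f(3) is_norm_on_nonneg[OF N x(1)] by simp
  qed
  ultimately show ?thesis by (rule that)
qed

lemma represents_conj_dual_if_bounded_below:
  assumes "c > 0" and "bounded_below c" and \<Lambda>: "\<Lambda> \<in> conj_dual_space D N"
  shows "\<exists>x. represents x \<Lambda>"
proof -
  obtain C where C: "\<And>x. x \<in> D \<Longrightarrow> cmod (\<Lambda> x) \<le> C * N x"
    using \<Lambda> unfolding conj_dual_space_def by blast
  have le: "cmod (\<Lambda> x) \<le> \<bar>C\<bar> * N x" if x: "x \<in> D" for x
    using C[OF x] mult_right_mono[OF abs_ge_self[of C] is_norm_on_nonneg[OF N x]] by simp
  obtain x where "represents x \<Lambda>"
    by (rule represents_if_bounded_below[OF assms(1,2), of \<Lambda> "\<bar>C\<bar>"])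
      (use \<Lambda> le in \<open>auto simp: conj_dual_space_def\<close>)
  then show ?thesis by blast
qed

text \<open>The functional \<open>B x\<close> is itself conjugate linear with bound
  \<open>K\<close>, hence represented by some \<open>x'\<close> with
  \<open>N x' \<le> K / c\<close>. Triviality of the null space identifies \<open>x'\<close> with
  \<open>x\<close>.\<close>

lemma bounded_below_adjoint:
  assumes c: "c > 0" and below: "bounded_below c" and null: "null_form D B = {0}"
  shows "reflexive_form.bounded_below D N (adjoint_form B) c"
  unfolding reflexive_form.bounded_below_def[OF reflexive_form_adjoint]
proof (intro ballI allI impI)
  fix x K assume x: "x \<in> D" and K: "K > (0::real)"
    and "\<forall>y\<in>D. cmod (adjoint_form B y x) \<le> K * N y"
  then have le: "cmod (B x y) \<le> K * N y" if "y \<in> D" for y using that by (simp add: adjoint_form_def)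
  obtain x' where x': "represents x' (B x)" "N x' \<le> K / c"
    by (rule represents_if_bounded_below[OF c below, of "B x" K])
      (use x le K in \<open>auto simp: B_add_right B_scale_right\<close>)
  have "x - x' \<in> null_form D B"
    using x x'(1) B_add_left[of "x - x'" x'] complex_vector.subspace_diff[OF D, of x x']
    by (auto simp: null_form_def represents_def)
  then show "c * N x \<le> K" using null x'(2) c by (simp add: field_simps)
qed

text \<open>If \<open>B x y\<close> vanishes for all \<open>x\<close>, then every positive
  \<open>K\<close> is a bound, which forces \<open>N y = 0\<close>.\<close>

lemma null_adjoint_if_bounded_below:
  assumes c: "c > 0" and below: "bounded_below c"
  shows "null_form D (adjoint_form B) = {0}"
proof -
  have "y = 0" if "y \<in> null_form D (adjoint_form B)" for y
  proof -
    have y: "y \<in> D" "\<And>x. x \<in> D \<Longrightarrow> B x y = 0"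
      using that by (auto simp: null_form_def adjoint_form_def)
    have "c * N y \<le> 0 + e" if e: "e > 0" for e
    proof -
      have "\<forall>x\<in>D. cmod (B x y) \<le> e * N x" using y e is_norm_on_nonneg[OF N] by simp
      then show ?thesis using below y e unfolding bounded_below_def by auto
    qed
    then have "c * N y \<le> 0" by (rule field_le_epsilon)
    then have "N y = 0" using c is_norm_on_nonneg[OF N y(1)] by (simp add: mult_le_0_iff)
    then show ?thesis using is_norm_on_eq_0_iff[OF N y(1)] by simp
  qed
  moreover have "0 \<in> null_form D (adjoint_form B)"
    using complex_vector.subspace_0[OF D] B_scale_right[of _ 0 0]
    by (auto simp: null_form_def adjoint_form_def)
  ultimately show ?thesis by blast
qed

text \<open>Surjectivity makes the set of those \<open>y\<close> for which \<open>B(\<cdot>, y)\<close> lies in the unit ball weakly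
  bounded, hence bounded.\<close>
lemma bounded_below_if_represents:
  assumes surj: "\<And>\<Lambda>. \<Lambda> \<in> conj_dual_space D N \<Longrightarrow> \<exists>x. represents x \<Lambda>"
  shows "\<exists>c>0. bounded_below c"
proof -
  let ?E = "dual_space D N" and ?M = "dual_norm D N"
  define Y where "Y = {y\<in>D. \<forall>x\<in>D. cmod (B x y) \<le> N x}"
  \<comment> \<open>The canonical image of \<open>y\<close> in the bidual, set to 0 outside the
    dual.\<close>
  define J where "J y = (\<lambda>f. if f \<in> ?E then f y else 0)" for y :: 'h
  note E = subspace_dual_space[OF D N]
  have JE: "J y \<in> dual_space ?E ?M" if y: "y \<in> D" for y
    by (rule dual_spaceI[where C = "N y"])
      (use y le_dual_norm[OF D N] complex_vector.subspace_add[OF E] complex_vector.subspace_scale[OF E]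
        in \<open>auto simp: J_def scaleC_fun_def scaleC_complex_def mult.commute\<close>)
  have "\<exists>K. \<forall>\<phi>\<in>J ` Y. dual_norm ?E ?M \<phi> \<le> K"
  proof (rule uniform_boundedness[OF is_banach_on_dual_space[OF D N]])
    show "J ` Y \<subseteq> dual_space ?E ?M" using JE by (auto simp: Y_def)
    fix f assume f: "f \<in> ?E"
    \<comment> \<open>Conjugating \<open>f\<close> makes surjectivity applicable: \<open>f y\<close>
      has the modulus of \<open>B x y\<close>, which is at most \<open>N x\<close> for every
      \<open>y\<close> in \<open>Y\<close>.\<close>
    have "(\<lambda>x. cnj (f x)) \<in> conj_dual_space D N"
      using f by (auto simp: dual_space_def conj_dual_space_def)
    then obtain x where x: "represents x (\<lambda>x. cnj (f x))" using surj by blast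
    have "cmod (J y f) \<le> N x" if y: "y \<in> Y" for y
    proof -
      have "cmod (f y) = cmod (B x y)"
        using x y complex_mod_cnj[of "f y"] by (simp add: represents_def Y_def)
      then show ?thesis using x y f by (simp add: represents_def Y_def J_def)
    qed
    then show "\<exists>K. \<forall>\<phi>\<in>J ` Y. cmod (\<phi> f) \<le> K" by blast
  qed
  then obtain K where K: "\<And>y. y \<in> Y \<Longrightarrow> dual_norm ?E ?M (J y) \<le> K" by blast
  \<comment> \<open>\<open>K\<close> is not known to be positive; \<open>max K 1\<close> can be
    divided by. The norm of \<open>y\<close> is recovered from that of \<open>J y\<close> through a
    norming functional.\<close>
  have NY: "N y \<le> max K 1" if y: "y \<in> Y" for y
  proof -
    have yD: "y \<in> D" using y by (simp add: Y_def)
    obtain f where f: "f \<in> ?E" "\<And>y. y \<in> D \<Longrightarrow> cmod (f y) \<le> N y" "f y = of_real (N y)"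
      using norming_functional[OF D N yD] by blast
    have "?M f \<le> 1" by (rule dual_norm_leI[OF D N]) (use f(2) in force)
    have "N y = cmod (J y f)" using f is_norm_on_nonneg[OF N yD] by (simp add: J_def)
    also have "\<dots> \<le> dual_norm ?E ?M (J y) * ?M f"
      by (rule le_dual_norm[OF E is_norm_on_dual_norm[OF D N] JE[OF yD] f(1)])
    also have "\<dots> \<le> max K 1 * 1"
      using K[OF y] \<open>?M f \<le> 1\<close> dual_norm_nonneg[OF D N f(1)] by (intro mult_mono) auto
    finally show ?thesis by simp
  qed
  have "bounded_below (1 / max K 1)"
    unfolding bounded_below_def
  proof (intro ballI allI impI)
    fix y k assume y: "y \<in> D" and k: "k > (0::real)" and le: "\<forall>x\<in>D. cmod (B x y) \<le> k * N x"
    have "of_real (1 / k) *\<^sub>C y \<in> Y"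
      using y le k D_scale[OF y, of "of_real (1 / k)"]
      by (auto simp: Y_def B_scale_right norm_mult norm_divide field_simps)
    then have "N (of_real (1 / k) *\<^sub>C y) \<le> max K 1" by (rule NY)
    then have "N y \<le> max K 1 * k" using k by (simp add: is_norm_on_scale[OF N y] norm_divide field_simps)
    moreover have "max K 1 > 0" by simp
    ultimately show "1 / max K 1 * N y \<le> k" by (simp add: pos_divide_le_eq mult.commute)
  qed
  moreover have "1 / max K 1 > 0" by simp
  ultimately show ?thesis by blast
qed

end

section \<open>Perturbations of q-closed forms\<close>

lemma adjoint_form_adjoint_form [simp]: "adjoint_form (adjoint_form B) = B"
  by (simp add: adjoint_form_def fun_eq_iff)

lemma adjoint_form_add: "adjoint_form (A + B) = adjoint_form A + adjoint_form B"
  by (simp add: adjoint_form_def fun_eq_iff)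

lemma sphere_sup_left_adjoint: "sphere_sup_left D N (adjoint_form B) = sphere_sup_right D N B"
  by (simp add: sphere_sup_left_def sphere_sup_right_def adjoint_form_def fun_eq_iff)

text \<open>The continuous embedding into the Hilbert space carries the bound on
  \<open>\<Upsilon>\<close> over to \<open>N\<close>, at the price of a factor
  \<open>\<alpha>\<close> in each variable.\<close>

lemma q_closed_perturbed_reflexive_form:
  assumes \<Omega>: "sesquilinear_on D \<Omega>" and q: "q_closed D N \<Omega>" and \<Upsilon>: "bounded_sesquilinear \<Upsilon>"
  shows "\<exists>M. reflexive_form D N (\<Omega> + \<Upsilon>) M"
proof -
  obtain \<alpha> \<beta> where \<alpha>: "\<alpha> > 0" "\<And>x. x \<in> D \<Longrightarrow> norm x \<le> \<alpha> * N x"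
    and \<beta>: "\<And>x y. x \<in> D \<Longrightarrow> y \<in> D \<Longrightarrow> cmod (\<Omega> x y) \<le> \<beta> * N x * N y"
    using q unfolding q_closed_def by blast
  obtain C where C: "\<And>x y. cmod (\<Upsilon> x y) \<le> C * norm x * norm y"
    using \<Upsilon> unfolding bounded_sesquilinear_def by blast
  have "cmod ((\<Omega> + \<Upsilon>) x y) \<le> (\<beta> + \<bar>C\<bar> * \<alpha> * \<alpha>) * N x * N y" if x: "x \<in> D" and y: "y \<in> D" for x y
  proof -
    have "cmod (\<Upsilon> x y) \<le> \<bar>C\<bar> * (norm x * norm y)"
      using C[of x y] mult_right_mono[OF abs_ge_self[of C], of "norm x * norm y"] by (simp add: mult.assoc)
    also have "\<dots> \<le> \<bar>C\<bar> * ((\<alpha> * N x) * (\<alpha> * N y))"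
      using \<alpha>(2)[OF x] \<alpha>(2)[OF y] order_trans[OF norm_ge_zero \<alpha>(2)[OF x]]
      by (intro mult_left_mono mult_mono) auto
    finally show ?thesis
      using \<beta>[OF x y] norm_triangle_ineq[of "\<Omega> x y" "\<Upsilon> x y"] by (simp add: algebra_simps)
  qed
  moreover have "sesquilinear_on D (\<Omega> + \<Upsilon>)"
    using \<Omega> \<Upsilon> by (simp add: sesquilinear_on_def bounded_sesquilinear_def algebra_simps)
  moreover have "is_reflexive_banach_on D N" using q by (simp add: q_closed_def)
  ultimately show ?thesis by (intro exI reflexive_form.intro)
qed

theorem lemma5p1:
  fixes D :: "'h::complex_hilbert set"
    and \<Omega> \<Upsilon> :: "'h \<Rightarrow> 'h \<Rightarrow> complex"
    and N :: "'h \<Rightarrow> real"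
  defines "a \<equiv> null_form D (\<Omega> + \<Upsilon>) = {0}"
    and "b \<equiv> null_form D (adjoint_form \<Omega> + adjoint_form \<Upsilon>) = {0}"
    and "c \<equiv> \<exists>c\<^sub>1>0. \<forall>\<xi>\<in>D. ennreal (c\<^sub>1 * N \<xi>) \<le> sphere_sup_right D N (\<Omega> + \<Upsilon>) \<xi>"
    and "d \<equiv> \<exists>c\<^sub>2>0. \<forall>\<eta>\<in>D. ennreal (c\<^sub>2 * N \<eta>) \<le> sphere_sup_left D N (\<Omega> + \<Upsilon>) \<eta>"
    and "e \<equiv> \<forall>\<xi>::nat \<Rightarrow> 'h. (\<forall>n. \<xi> n \<in> D) \<longrightarrow>
               (\<lambda>n. sphere_sup_right D N (\<Omega> + \<Upsilon>) (\<xi> n)) \<longlonglongrightarrow> 0 \<longrightarrow> (\<lambda>n. N (\<xi> n)) \<longlonglongrightarrow> 0"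
    and "f \<equiv> \<forall>\<eta>::nat \<Rightarrow> 'h. (\<forall>n. \<eta> n \<in> D) \<longrightarrow>
               (\<lambda>n. sphere_sup_left D N (\<Omega> + \<Upsilon>) (\<eta> n)) \<longlonglongrightarrow> 0 \<longrightarrow> (\<lambda>n. N (\<eta> n)) \<longlonglongrightarrow> 0"
  assumes "complex_vector.subspace D"
    and "closure D = UNIV"
    and "sesquilinear_on D \<Omega>"
    and "q_closed D N \<Omega>"
    and "bounded_sesquilinear \<Upsilon>"
  shows "(c \<longleftrightarrow> e) \<and> (d \<longleftrightarrow> f) \<and>
    (\<Upsilon> \<in> perturbations D N \<Omega> \<longleftrightarrow> a \<and> d) \<and>
    (a \<and> d \<longleftrightarrow> b \<and> c) \<and>
    (b \<and> c \<longleftrightarrow> c \<and> d)"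
proof -
  let ?B = "\<Omega> + \<Upsilon>"
  obtain M where M: "reflexive_form D N ?B M"
    using q_closed_perturbed_reflexive_form[OF assms(9-11)] by blast
  interpret B: reflexive_form D N ?B M by (rule M)
  \<comment> \<open>Statements (b) and (c) for \<open>?B\<close> are (a) and (d) for its
    adjoint.\<close>
  interpret A: reflexive_form D N "adjoint_form ?B" M by (rule B.reflexive_form_adjoint)
  have d: "d \<longleftrightarrow> (\<exists>k>0. B.bounded_below k)"
    using B.bounded_below_iff by (auto simp: d_def)
  have c: "c \<longleftrightarrow> (\<exists>k>0. A.bounded_below k)"
    using A.bounded_below_iff by (auto simp: c_def sphere_sup_left_adjoint)
  have b: "b \<longleftrightarrow> null_form D (adjoint_form ?B) = {0}"
    by (simp add: b_def adjoint_form_add)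
  have "d \<longleftrightarrow> f"
    unfolding d f_def by (rule B.bounded_below_iff_sequential)
  moreover have "c \<longleftrightarrow> e"
    unfolding c e_def using A.bounded_below_iff_sequential by (simp only: sphere_sup_left_adjoint)
  moreover have "d \<longrightarrow> b"
    unfolding b d by (intro impI) (elim exE conjE, rule B.null_adjoint_if_bounded_below)
  \<comment> \<open>In the interpretation \<open>A\<close> the adjoint form is a double adjoint,
    which \<open>[simplified]\<close> reduces to \<open>?B\<close>.\<close>
  moreover have "c \<longrightarrow> a"
    unfolding a_def c
    by (intro impI) (elim exE conjE, rule A.null_adjoint_if_bounded_below[simplified])
  moreover have "a \<and> d \<longrightarrow> c"
    unfolding a_def c d
    by (intro impI) (elim exE conjE, intro exI conjI B.bounded_below_adjoint)
  moreover have "b \<and> c \<longrightarrow> d"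
    unfolding b c d
    by (intro impI) (elim exE conjE, intro exI conjI A.bounded_below_adjoint[simplified])
  moreover have "\<Upsilon> \<in> perturbations D N \<Omega> \<longleftrightarrow>
      a \<and> (\<forall>\<Lambda>\<in>conj_dual_space D N. \<exists>x. B.represents x \<Lambda>)"
    by (simp add: a_def perturbations_def B.represents_def Bex_def assms(11))
  \<comment> \<open>Representability by itself is equivalent to (d); in the set of perturbations it
    is joined with (a).\<close>
  moreover have "(\<forall>\<Lambda>\<in>conj_dual_space D N. \<exists>x. B.represents x \<Lambda>) \<longleftrightarrow> d"
    unfolding d
  proof
    assume "\<forall>\<Lambda>\<in>conj_dual_space D N. \<exists>x. B.represents x \<Lambda>"
    then show "\<exists>k>0. B.bounded_below k" by (intro B.bounded_below_if_represents) simp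
  next
    assume "\<exists>k>0. B.bounded_below k"
    then obtain k where "k > 0" "B.bounded_below k" by (elim exE conjE)
    then show "\<forall>\<Lambda>\<in>conj_dual_space D N. \<exists>x. B.represents x \<Lambda>"
      by (intro ballI B.represents_conj_dual_if_bounded_below)
  qed
  \<comment> \<open>Propositional: (c) gives (a), (d) gives (b), and each of the pairs (a), (d) and
    (b), (c) gives the remaining lower bound.\<close>
  ultimately show ?thesis by argo
qed

end
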